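(* Let $G=(V,E)$ be a chain graph with chain components $(\tau\mid\tau\in\mathscr{T})$. A probability vector $p\in\Delta^o$ belongs to the discrete chain graph model $\mathbf{P}_{\mathrm{IV}}(G)$ if and only if the following three conditions hold: (i) For all $i\in\mathcal{I}$, $p(i)=\prod_{\tau\in\mathscr{T}}p(i_\tau\mid i_{\mathrm{pa}_D(\tau)})$. (ii) For all $\tau\in\mathscr{T}$ and $i_{\mathrm{pa}_D(\tau)}\in\mathcal{I}_{\mathrm{pa}_D(\tau)}$, the saturated Möbius parameters of $p$ satisfy $$q(j_\delta\mid i_{\mathrm{pa}_D(\tau)})=q(j_{\gamma_1}\mid i_{\mathrm{pa}_D(\tau)})\,q(j_{\gamma_2}\mid i_{\mathrm{pa}_D(\tau)})\cdots q(j_{\gamma_r}\mid i_{\mathrm{pa}_D(\tau)})$$ for every disconnected set $\delta\subseteq\tau$ and every $j_\delta\in\mathcal{J}_\delta$, where $\delta=\gamma_1\,\dot\cup\,\cdots\,\dot\cup\,\gamma_r$ is the unique partition of $\delta$ into inclusion-maximal connected sets. (iii) For all $\tau\in\mathscr{T}$, all connected subsets $\gamma\subseteq\tau$ and all $j_\gamma\in\mathcal{J}_\gamma$, the saturated Möbius parameters of $p$ satisfy $$q(j_\gamma\mid i_{\mathrm{pa}_D(\tau)})=q(j_\gamma\mid k_{\mathrm{pa}_D(\tau)})$$ for every pair $i_{\mathrm{pa}_D(\tau)},k_{\mathrm{pa}_D(\tau)}\in\mathcal{I}_{\mathrm{pa}_D(\tau)}$ such that $i_{\mathrm{pa}_G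(\gamma)}=k_{\mathrm{pa}_G(\gamma)}$.
   Context: Graphs. $G=(V,E)$ has finite vertex set $V$ and $E\subseteq(V\times V)\setminus\{(v,v):v\in V\}$. An edge $(v,w)\in E$ is undirected ($v-w$) if $(w,v)\in E$, and directed ($v\to w$) otherwise. If $v\to w$, $v$ is a parent of $w$; if $v-w$, $v$ is a neighbor of $w$; $\mathrm{pa}_G(v)$ and $\mathrm{nb}_G(v)$ are the sets of parents and neighbors of $v$. For $\sigma\subseteq V$, $\mathrm{pa}_G(\sigma)=(\bigcup_{v\in\sigma}\mathrm{pa}_G(v))\setminus\sigma$, $\mathrm{nb}_G(\sigma)=(\bigcup_{v\in\sigma}\mathrm{nb}_G(v))\setminus\sigma$, $\mathrm{Nb}_G(\sigma)=\mathrm{nb}_G(\sigma)\cup\sigma$. A semi-directed cycle is a sequence of distinct vertices $v_0,\dots,v_k$ with $(v_i,v_{i+1})\in E$ for $0\le i\le k$ (where $v_{k+1}=v_0$), at least one of these edges being directed. A chain graph is a graph without semi-directed cycles. Its chain components are the equivalence classes of vertices under the relation "joined by a path of undirected edges"; $\mathscr{T}$ is the set of chain components. $D=D(G)$ is the acyclic digraph with vertex set $\mathscr{T}$ and an edge $\tau_1\to\tau_2$ iff $v\to w$ in $G$ for some $v\in\tau_1,w\in\tau_2$. For $\tau\in\mathscr{T}$, $\mathrm{pa}_D(\tau)\subseteq V$ is the union of all parents of $\tau$ in $D$, and $\mathrm{nd}_D(\tau)\subseteq V$ is the union of all $\bar\tau\in\mathscr{T}\setminus\{\tau\}$ such that there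 is no directed path from $\tau$ to $\bar\tau$ in $D$. A nonempty subset of a chain component is connected if it induces a connected subgraph of $G$, and disconnected otherwise. Model. $X=(X_v\mid v\in V)$ is a random vector with $X_v$ taking values in $[d_v]=\{1,\dots,d_v\}$; $\mathcal{I}=\prod_{v\in V}[d_v]$ and $\mathcal{I}_\alpha=\prod_{v\in\alpha}[d_v]$ for $\alpha\subseteq V$; $i_\alpha$ denotes the subvector of $i$ indexed by $\alpha$. Joint distributions are identified with vectors $p=(p(i)\mid i\in\mathcal{I})$, $p(i)=P(X=i)$, in the probability simplex $\Delta$; $\Delta^o$ is its interior (all $p(i)>0$). Write $p(i_\tau\mid i_{\mathrm{pa}_D(\tau)})=P(X_\tau=i_\tau\mid X_{\mathrm{pa}_D(\tau)}=i_{\mathrm{pa}_D(\tau)})$. For disjoint $\alpha,\beta,\gamma\subseteq V$, $\alpha\perp\!\!\!\perp\beta\mid\gamma$ means that $X_\alpha$ and $X_\beta$ are conditionally independent given $X_\gamma$ (marginally independent if $\gamma=\varnothing$; void if $\alpha$ or $\beta$ is empty). The model $\mathbf{P}_{\mathrm{IV}}(G)$ is the set of $p\in\Delta^o$ obeying the block-recursive Markov property of type IV: for all $\tau\in\mathscr{T}$ and all $\sigma\subseteq\tau$, (C1) $\tau\perp\!\!\!\perp[\mathrm{nd}_D(\tau)\setminus\mathrm{pa}_D(\tau)]\mid\mathrm{pa}_D(\tau)$; (C2b) $\sigma\perp\!\!\!\perp[\tau\setminus\mathrm{Nb}_G(\sigma)]\mid\mathrm{pa}_D(\tau)$; (C3b)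 $\sigma\perp\!\!\!\perp[\mathrm{pa}_D(\tau)\setminus\mathrm{pa}_G(\sigma)]\mid\mathrm{pa}_G(\sigma)$. Saturated Möbius parameters. For $\varnothing\ne\sigma\subseteq\tau\in\mathscr{T}$ let $\mathcal{J}_\sigma=\prod_{v\in\sigma}[d_v-1]$. For $j_\sigma\in\mathcal{J}_\sigma$ and $i_{\mathrm{pa}_D(\tau)}\in\mathcal{I}_{\mathrm{pa}_D(\tau)}$, set $q(j_\sigma\mid i_{\mathrm{pa}_D(\tau)})=P(X_\sigma=j_\sigma\mid X_{\mathrm{pa}_D(\tau)}=i_{\mathrm{pa}_D(\tau)})$. *)

theory Defs
  imports "HOL-Probability.Probability"
begin

section \<open>Graphs\<close>

definition graph :: "'v set \<Rightarrow> ('v \<times> 'v) set \<Rightarrow> bool" where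
  "graph V E \<longleftrightarrow> finite V \<and> E \<subseteq> V \<times> V - Id"

definition undirected_edges :: "('v \<times> 'v) set \<Rightarrow> ('v \<times> 'v) set" where
  "undirected_edges E = {(v, w). (v, w) \<in> E \<and> (w, v) \<in> E}"

definition directed_edges :: "('v \<times> 'v) set \<Rightarrow> ('v \<times> 'v) set" where
  "directed_edges E = {(v, w). (v, w) \<in> E \<and> (w, v) \<notin> E}"

definition parents :: "('v \<times> 'v) set \<Rightarrow> 'v \<Rightarrow> 'v set" where
  "parents E v = {u. (u, v) \<in> directed_edges E}"

definition neighbors :: "('v \<times> 'v) set \<Rightarrow> 'v \<Rightarrow> 'v set" where
  "neighbors E v = {u. (u, v) \<in> undirected_edges E}"

definition pa_G :: "('v \<times> 'v) set \<Rightarrow> 'v set \<Rightarrow> 'v set" where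
  "pa_G E \<sigma> = (\<Union>v\<in>\<sigma>. parents E v) - \<sigma>"

definition nb_G :: "('v \<times> 'v) set \<Rightarrow> 'v set \<Rightarrow> 'v set" where
  "nb_G E \<sigma> = (\<Union>v\<in>\<sigma>. neighbors E v) - \<sigma>"

definition Nb_G :: "('v \<times> 'v) set \<Rightarrow> 'v set \<Rightarrow> 'v set" where
  "Nb_G E \<sigma> = nb_G E \<sigma> \<union> \<sigma>"

definition semi_directed_cycle :: "'v set \<Rightarrow> ('v \<times> 'v) set \<Rightarrow> 'v list \<Rightarrow> bool" where
  "semi_directed_cycle V E vs \<longleftrightarrow>
     vs \<noteq> [] \<and> set vs \<subseteq> V \<and> distinct vs \<and>
     (\<forall>i<length vs. (vs ! i, vs ! (Suc i mod length vs)) \<in> E) \<and>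
     (\<exists>i<length vs. (vs ! i, vs ! (Suc i mod length vs)) \<in> directed_edges E)"

definition chain_graph :: "'v set \<Rightarrow> ('v \<times> 'v) set \<Rightarrow> bool" where
  "chain_graph V E \<longleftrightarrow> graph V E \<and> \<not> (\<exists>vs. semi_directed_cycle V E vs)"

definition chain_components :: "'v set \<Rightarrow> ('v \<times> 'v) set \<Rightarrow> 'v set set" where
  "chain_components V E = V // (undirected_edges E)\<^sup>*"

text \<open>The edge set of the digraph \<open>D\<close> on the chain components.\<close>

definition component_edges :: "'v set \<Rightarrow> ('v \<times> 'v) set \<Rightarrow> ('v set \<times> 'v set) set" where
  "component_edges V E =
     {(\<tau>1, \<tau>2). \<tau>1 \<in> chain_components V E \<and> \<tau>2 \<in> chain_components V E \<and>
                (\<exists>v\<in>\<tau>1. \<exists>w\<in>\<tau>2. (v, w) \<in> directed_edges E)}"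

definition pa_D :: "'v set \<Rightarrow> ('v \<times> 'v) set \<Rightarrow> 'v set \<Rightarrow> 'v set" where
  "pa_D V E \<tau> = \<Union> {\<tau>'. (\<tau>', \<tau>) \<in> component_edges V E}"

definition nd_D :: "'v set \<Rightarrow> ('v \<times> 'v) set \<Rightarrow> 'v set \<Rightarrow> 'v set" where
  "nd_D V E \<tau> =
     \<Union> {\<tau>' \<in> chain_components V E - {\<tau>}. (\<tau>, \<tau>') \<notin> (component_edges V E)\<^sup>+}"

text \<open>
  Connectedness of the subgraph induced by \<open>\<gamma>\<close>, ignoring edge directions. The notion is only
  applied to subsets of a chain component of a chain graph, where all edges are undirected.
\<close>

definition connected_set :: "('v \<times> 'v) set \<Rightarrow> 'v set \<Rightarrow> bool" where
  "connected_set E \<gamma> \<longleftrightarrow>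
     \<gamma> \<noteq> {} \<and> (\<forall>v\<in>\<gamma>. \<forall>w\<in>\<gamma>. (v, w) \<in> (E \<inter> \<gamma> \<times> \<gamma> \<union> (E \<inter> \<gamma> \<times> \<gamma>)\<inverse>)\<^sup>*)"

definition disconnected_set :: "('v \<times> 'v) set \<Rightarrow> 'v set \<Rightarrow> bool" where
  "disconnected_set E \<delta> \<longleftrightarrow> \<delta> \<noteq> {} \<and> \<not> connected_set E \<delta>"

definition max_connected_subsets :: "('v \<times> 'v) set \<Rightarrow> 'v set \<Rightarrow> 'v set set" where
  "max_connected_subsets E \<delta> =
     {\<gamma>. \<gamma> \<subseteq> \<delta> \<and> connected_set E \<gamma> \<and>
         (\<forall>\<gamma>'. \<gamma>' \<subseteq> \<delta> \<and> connected_set E \<gamma>' \<and> \<gamma> \<subseteq> \<gamma>' \<longrightarrow> \<gamma>' = \<gamma>)}"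


section \<open>Discrete distributions\<close>

text \<open>
  Vectors indexed by \<open>\<alpha>\<close> are functions that are \<^term>\<open>undefined\<close> outside \<open>\<alpha>\<close>, so the subvector
  of \<open>i\<close> indexed by \<open>\<alpha>\<close> is \<^term>\<open>restrict i \<alpha>\<close>.
\<close>

definition states :: "('v \<Rightarrow> nat) \<Rightarrow> 'v set \<Rightarrow> ('v \<Rightarrow> nat) set" where
  "states d \<alpha> = (\<Pi>\<^sub>E v\<in>\<alpha>. {1..d v})"

definition reduced_states :: "('v \<Rightarrow> nat) \<Rightarrow> 'v set \<Rightarrow> ('v \<Rightarrow> nat) set" where
  "reduced_states d \<sigma> = (\<Pi>\<^sub>E v\<in>\<sigma>. {1..<d v})"

text \<open>
  A point of the probability simplex is a probability mass function supported in
  \<^term>\<open>states d V\<close>; its coordinates are \<^term>\<open>pmf p i\<close>. The random vector \<open>X\<close> is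
  the identity map under \<open>p\<close>.
\<close>

definition prob_simplex :: "'v set \<Rightarrow> ('v \<Rightarrow> nat) \<Rightarrow> ('v \<Rightarrow> nat) pmf set" where
  "prob_simplex V d = {p. set_pmf p \<subseteq> states d V}"

definition prob_simplex_interior :: "'v set \<Rightarrow> ('v \<Rightarrow> nat) \<Rightarrow> ('v \<Rightarrow> nat) pmf set" where
  "prob_simplex_interior V d = {p \<in> prob_simplex V d. \<forall>i\<in>states d V. pmf p i > 0}"

text \<open>\<open>P(X\<^sub>\<alpha> = a | X\<^sub>\<beta> = b)\<close>, where \<open>a\<close> and \<open>b\<close> are vectors indexed by \<open>\<alpha>\<close> and \<open>\<beta>\<close>.\<close>

definition cprob ::
  "('v \<Rightarrow> nat) pmf \<Rightarrow> 'v set \<Rightarrow> ('v \<Rightarrow> nat) \<Rightarrow> 'v set \<Rightarrow> ('v \<Rightarrow> nat) \<Rightarrow> real" where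
  "cprob p \<alpha> a \<beta> b = \<P>(x in measure_pmf p. restrict x \<alpha> = a \<bar> restrict x \<beta> = b)"

text \<open>
  If \<open>\<gamma>\<close> is empty the conditioning event is certain for \<open>c = restrict x {}\<close>, and this is
  marginal independence; if \<open>\<alpha>\<close> or \<open>\<beta>\<close> is empty it always holds.
\<close>

definition cond_indep ::
  "('v \<Rightarrow> nat) pmf \<Rightarrow> 'v set \<Rightarrow> 'v set \<Rightarrow> 'v set \<Rightarrow> bool" where
  "cond_indep p \<alpha> \<beta> \<gamma> \<longleftrightarrow>
     (\<forall>a b c. \<P>(x in measure_pmf p. restrict x \<gamma> = c) > 0 \<longrightarrow>
        \<P>(x in measure_pmf p. restrict x \<alpha> = a \<and> restrict x \<beta> = b \<bar> restrict x \<gamma> = c) =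
        cprob p \<alpha> a \<gamma> c * cprob p \<beta> b \<gamma> c)"

definition P_IV :: "'v set \<Rightarrow> ('v \<times> 'v) set \<Rightarrow> ('v \<Rightarrow> nat) \<Rightarrow> ('v \<Rightarrow> nat) pmf set" where
  "P_IV V E d =
     {p \<in> prob_simplex_interior V d.
        \<forall>\<tau>\<in>chain_components V E. \<forall>\<sigma>. \<sigma> \<subseteq> \<tau> \<longrightarrow>
          cond_indep p \<tau> (nd_D V E \<tau> - pa_D V E \<tau>) (pa_D V E \<tau>) \<and>
          cond_indep p \<sigma> (\<tau> - Nb_G E \<sigma>) (pa_D V E \<tau>) \<and>
          cond_indep p \<sigma> (pa_D V E \<tau> - pa_G E \<sigma>) (pa_G E \<sigma>)}"

text \<open>
  The saturated Moebius parameter \<open>q(j\<^sub>\<sigma> | i)\<close> for \<open>\<sigma> \<subseteq> \<tau>\<close>, \<open>j \<in> reduced_states d \<sigma>\<close> and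
  \<open>i \<in> states d (pa_D V E \<tau>)\<close>.
\<close>

definition moebius_param ::
  "'v set \<Rightarrow> ('v \<times> 'v) set \<Rightarrow> ('v \<Rightarrow> nat) pmf \<Rightarrow> 'v set \<Rightarrow> 'v set \<Rightarrow> ('v \<Rightarrow> nat) \<Rightarrow> ('v \<Rightarrow> nat) \<Rightarrow> real"
  where "moebius_param V E p \<tau> \<sigma> j i = cprob p \<sigma> j (pa_D V E \<tau>) i"

end

theory Submission
  imports Defs
begin

text \<open>
  Along a parent-closed family of components the joint distribution factorizes into the conditional
  distributions given the parents: removing a sink of \<open>D\<close> uses (C1), and conversely summing out
  the components one by one transports the factorization of \<open>p\<close> to the nondescendants of a
  component. Within a component, every independence or invariance statement is an identity between
  two families of marginals. Such families obey the same summation rule, so it suffices to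
  compare them on states avoiding the top values \<open>d v\<close>, that is, on Moebius parameters, where
  the claim follows by splitting a set into its maximal connected subsets. Disconnected sets in
  (C3b) are thereby reduced to connected ones.
\<close>

section \<open>Chain graphs\<close>

text \<open>State vectors are handled as total functions and events have the form
  \<open>agree A i\<close>, so one vector serves every index set, two vectors are glued by
  \<open>override_on\<close>, and restrictions reappear only in the final translation. Since
  \<open>p\<close> is positive, \<open>P (agree A i) > 0\<close> says exactly that the values of
  \<open>i\<close> on \<open>A\<close> are in range; a single condition thus expresses both being a
  state and legitimate conditioning.

  Inclusion-exclusion compares marginals on all subsets, so the product formula is needed for empty
  and connected sets as well, where it is trivial. Passing from connected to disconnected sets in
  (C3b) works because the parents of a connected piece are among the parents of the whole set:
  configurations that agree on the latter give equal factors. The outcome is invariance between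
  configurations of \<open>pa_D\<close>; (C3b) itself, which conditions on \<open>pa_G\<close>
  alone, is recovered by averaging.\<close>

lemma distinct_walk:
  assumes "(v, u) \<in> E\<^sup>*"
  shows "\<exists>vs. vs \<noteq> [] \<and> hd vs = v \<and> last vs = u \<and> distinct vs \<and> successively (\<lambda>a b. (a, b) \<in> E) vs"
  using assms
proof (induction rule: converse_rtrancl_induct)
  case base
  show ?case by (rule exI[of _ "[u]"]) simp
next
  case (step v y)
  then obtain ys where ys: "ys \<noteq> []" "hd ys = y" "last ys = u" "distinct ys"
    "successively (\<lambda>a b. (a, b) \<in> E) ys" by blast
  show ?case
  proof (cases "v \<in> set ys")
    case True
    \<comment> \<open>The walk comes back to \<open>v\<close>: cut off everything before that later
      visit.\<close>
    then obtain as bs where "ys = as @ v # bs" by (meson split_list)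
    with ys show ?thesis
      by (intro exI[of _ "v # bs"]) (auto simp: successively_append_iff)
  next
    case False
    with ys step(1) show ?thesis
      by (intro exI[of _ "v # ys"]) (auto simp: successively_Cons)
  qed
qed

section \<open>Connected sets and maximal connected subsets\<close>

lemma connected_set_Un:
  assumes "connected_set E \<alpha>" "connected_set E \<beta>"
    and "u \<in> \<alpha>" "v \<in> \<beta>" and "u = v \<or> (u, v) \<in> E \<or> (v, u) \<in> E"
  shows "connected_set E (\<alpha> \<union> \<beta>)"
proof -
  let ?R = "\<lambda>\<gamma>. E \<inter> \<gamma> \<times> \<gamma> \<union> (E \<inter> \<gamma> \<times> \<gamma>)\<inverse>"
  have sub: "(?R \<alpha>)\<^sup>* \<subseteq> (?R (\<alpha> \<union> \<beta>))\<^sup>*" "(?R \<beta>)\<^sup>* \<subseteq> (?R (\<alpha> \<union> \<beta>))\<^sup>*"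
    by (rule rtrancl_mono, blast)+
  have sym: "sym ((?R (\<alpha> \<union> \<beta>))\<^sup>*)"
    by (intro sym_rtrancl) (auto simp: sym_def)
  have uv: "(u, v) \<in> (?R (\<alpha> \<union> \<beta>))\<^sup>*"
    using assms(3-5) by auto
  \<comment> \<open>Every vertex is routed to \<open>u\<close>, those of \<beta> via
    \<open>v\<close>; symmetry of the relation reverses such paths, so any two vertices are joined
    through \<open>u\<close>.\<close>
  have to_u: "(w, u) \<in> (?R (\<alpha> \<union> \<beta>))\<^sup>*" if "w \<in> \<alpha> \<union> \<beta>" for w
  proof (cases "w \<in> \<alpha>")
    case True
    then show ?thesis using assms(1,3) sub unfolding connected_set_def by blast
  next
    case False
    then have "(w, v) \<in> (?R (\<alpha> \<union> \<beta>))\<^sup>*"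
      using that assms(2,4) sub unfolding connected_set_def by blast
    then show ?thesis using uv symD[OF sym] by (meson rtrancl_trans)
  qed
  show ?thesis
    unfolding connected_set_def
  proof (intro conjI ballI)
    fix x y assume "x \<in> \<alpha> \<union> \<beta>" "y \<in> \<alpha> \<union> \<beta>"
    then show "(x, y) \<in> (?R (\<alpha> \<union> \<beta>))\<^sup>*"
      using rtrancl_trans[OF to_u symD[OF sym to_u]] by blast
  qed (use assms(3) in blast)
qed

lemma connected_set_singleton: "connected_set E {v}"
  by (simp add: connected_set_def)

lemma max_connected_subsetsD:
  assumes "\<gamma> \<in> max_connected_subsets E \<delta>"
  shows "\<gamma> \<subseteq> \<delta>" "connected_set E \<gamma>"
    and "\<And>\<gamma>'. \<gamma>' \<subseteq> \<delta> \<Longrightarrow> connected_set E \<gamma>' \<Longrightarrow> \<gamma> \<subseteq> \<gamma>' \<Longrightarrow> \<gamma>' = \<gamma>"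
  using assms by (auto simp: max_connected_subsets_def)

lemma max_connected_subsetsI:
  assumes "\<gamma> \<subseteq> \<delta>" "connected_set E \<gamma>"
    and "\<And>\<gamma>'. \<gamma>' \<subseteq> \<delta> \<Longrightarrow> connected_set E \<gamma>' \<Longrightarrow> \<gamma> \<subseteq> \<gamma>' \<Longrightarrow> \<gamma>' = \<gamma>"
  shows "\<gamma> \<in> max_connected_subsets E \<delta>"
  using assms by (auto simp: max_connected_subsets_def)

lemma max_connected_subsets_connected:
  assumes "connected_set E \<gamma>"
  shows "max_connected_subsets E \<gamma> = {\<gamma>}"
  using assms unfolding max_connected_subsets_def by blast

lemma max_connected_subsets_empty: "max_connected_subsets E {} = {}"
  unfolding max_connected_subsets_def connected_set_def by auto

lemma finite_max_connected_subsets: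
  assumes "finite \<delta>"
  shows "finite (max_connected_subsets E \<delta>)"
  by (rule finite_subset[of _ "Pow \<delta>"]) (use assms in \<open>auto simp: max_connected_subsets_def\<close>)

text \<open>A singleton is connected and, by finiteness, extends to an inclusion-maximal connected
  subset.\<close>

lemma Union_max_connected_subsets:
  assumes "finite \<delta>"
  shows "\<Union> (max_connected_subsets E \<delta>) = \<delta>"
proof
  show "\<delta> \<subseteq> \<Union> (max_connected_subsets E \<delta>)"
  proof
    fix v assume "v \<in> \<delta>"
    let ?C = "{\<gamma>. \<gamma> \<subseteq> \<delta> \<and> connected_set E \<gamma>}"
    have "finite ?C" by (rule finite_subset[of _ "Pow \<delta>"]) (use assms in auto)
    moreover have "{v} \<in> ?C" using \<open>v \<in> \<delta>\<close> connected_set_singleton by auto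
    ultimately obtain \<gamma> where \<gamma>: "\<gamma> \<in> ?C" "{v} \<subseteq> \<gamma>" "\<forall>\<gamma>'\<in>?C. \<gamma> \<subseteq> \<gamma>' \<longrightarrow> \<gamma> = \<gamma>'"
      using finite_has_maximal2[of ?C "{v}"] by blast
    then have "\<gamma> \<in> max_connected_subsets E \<delta>"
      by (intro max_connected_subsetsI) auto
    then show "v \<in> \<Union> (max_connected_subsets E \<delta>)"
      using \<gamma>(2) by blast
  qed
qed (use max_connected_subsetsD(1) in blast)

text \<open>A common vertex or an edge across would make the union connected, and by maximality both
  sets would equal that union.\<close>

lemma max_connected_subsets_separated:
  assumes "\<alpha> \<in> max_connected_subsets E \<delta>" "\<beta> \<in> max_connected_subsets E \<delta>" "\<alpha> \<noteq> \<beta>"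
    and "u \<in> \<alpha>" "v \<in> \<beta>"
  shows "u \<noteq> v" "(u, v) \<notin> E" "(v, u) \<notin> E"
proof -
  have "\<not> (u = v \<or> (u, v) \<in> E \<or> (v, u) \<in> E)"
  proof
    assume "u = v \<or> (u, v) \<in> E \<or> (v, u) \<in> E"
    then have c: "connected_set E (\<alpha> \<union> \<beta>)"
      by (rule connected_set_Un[OF max_connected_subsetsD(2)[OF assms(1)]
            max_connected_subsetsD(2)[OF assms(2)] assms(4,5)])
    have s: "\<alpha> \<union> \<beta> \<subseteq> \<delta>"
      using max_connected_subsetsD(1) assms(1,2) by blast
    have "\<alpha> \<union> \<beta> = \<alpha>" "\<alpha> \<union> \<beta> = \<beta>"
      using max_connected_subsetsD(3)[OF assms(1) s c] max_connected_subsetsD(3)[OF assms(2) s c]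
      by auto
    then show False using assms(3) by simp
  qed
  then show "u \<noteq> v" "(u, v) \<notin> E" "(v, u) \<notin> E" by auto
qed

text \<open>A path inside \<gamma> that starts in \<alpha> never leaves it, because each step ends
  in \<open>\<alpha> \<union> \<beta>\<close> and no edge crosses.\<close>

lemma connected_subset_separated:
  assumes "connected_set E \<gamma>" "\<gamma> \<subseteq> \<alpha> \<union> \<beta>" "\<alpha> \<inter> \<beta> = {}"
    and "\<And>u v. u \<in> \<alpha> \<Longrightarrow> v \<in> \<beta> \<Longrightarrow> (u, v) \<notin> E \<and> (v, u) \<notin> E"
  shows "\<gamma> \<subseteq> \<alpha> \<or> \<gamma> \<subseteq> \<beta>"
proof (rule ccontr)
  assume "\<not> ?thesis"
  then obtain u v where uv: "u \<in> \<gamma>" "v \<in> \<gamma>" "u \<in> \<alpha>" "v \<in> \<beta>" using assms(2) by blast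
  then have "(u, v) \<in> (E \<inter> \<gamma> \<times> \<gamma> \<union> (E \<inter> \<gamma> \<times> \<gamma>)\<inverse>)\<^sup>*"
    using assms(1) unfolding connected_set_def by blast
  then have "v \<in> \<alpha>"
    using uv(3) by (induction rule: rtrancl_induct) (use assms(2,4) in blast)+
  then show False using uv(4) assms(3) by blast
qed

text \<open>A connected subset of the union lies on exactly one side (being nonempty, it cannot lie
  on both), so maximality in the union and maximality on that side coincide.\<close>

lemma max_connected_subsets_Un:
  assumes "\<alpha> \<inter> \<beta> = {}"
    and "\<And>u v. u \<in> \<alpha> \<Longrightarrow> v \<in> \<beta> \<Longrightarrow> (u, v) \<notin> E \<and> (v, u) \<notin> E"
  shows "max_connected_subsets E (\<alpha> \<union> \<beta>) = max_connected_subsets E \<alpha> \<union> max_connected_subsets E \<beta>"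
proof -
  have split: "\<gamma> \<subseteq> \<alpha> \<and> \<not> \<gamma> \<subseteq> \<beta> \<or> \<gamma> \<subseteq> \<beta> \<and> \<not> \<gamma> \<subseteq> \<alpha>" if "connected_set E \<gamma>" "\<gamma> \<subseteq> \<alpha> \<union> \<beta>" for \<gamma>
  proof -
    have "\<gamma> \<noteq> {}" using that unfolding connected_set_def by blast
    then show ?thesis using connected_subset_separated[OF that assms] assms(1) by blast
  qed
  show ?thesis
  proof (intro set_eqI iffI)
    fix \<gamma> assume "\<gamma> \<in> max_connected_subsets E (\<alpha> \<union> \<beta>)"
    note \<gamma> = max_connected_subsetsD[OF this]
    from split[OF \<gamma>(2,1)] show "\<gamma> \<in> max_connected_subsets E \<alpha> \<union> max_connected_subsets E \<beta>"
    proof (elim disjE conjE)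
      assume "\<gamma> \<subseteq> \<alpha>"
      then have "\<gamma> \<in> max_connected_subsets E \<alpha>" by (intro max_connected_subsetsI \<gamma>) auto
      then show ?thesis ..
    next
      assume "\<gamma> \<subseteq> \<beta>"
      then have "\<gamma> \<in> max_connected_subsets E \<beta>" by (intro max_connected_subsetsI \<gamma>) auto
      then show ?thesis ..
    qed
  next
    fix \<gamma> assume "\<gamma> \<in> max_connected_subsets E \<alpha> \<union> max_connected_subsets E \<beta>"
    then show "\<gamma> \<in> max_connected_subsets E (\<alpha> \<union> \<beta>)"
    proof
      assume "\<gamma> \<in> max_connected_subsets E \<alpha>"
      note \<gamma> = max_connected_subsetsD[OF this]
      from \<gamma>(1) have sub: "\<gamma> \<subseteq> \<alpha> \<union> \<beta>" by blast
      show ?thesis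
      proof (intro max_connected_subsetsI sub \<gamma>(2))
        fix \<gamma>' assume *: "\<gamma>' \<subseteq> \<alpha> \<union> \<beta>" "connected_set E \<gamma>'" "\<gamma> \<subseteq> \<gamma>'"
        have "\<gamma>' \<subseteq> \<alpha>" using split[OF *(2,1)] split[OF \<gamma>(2) sub] *(3) \<gamma>(1) by auto
        then show "\<gamma>' = \<gamma>" using * by (intro \<gamma>(3))
      qed
    next
      assume "\<gamma> \<in> max_connected_subsets E \<beta>"
      note \<gamma> = max_connected_subsetsD[OF this]
      from \<gamma>(1) have sub: "\<gamma> \<subseteq> \<alpha> \<union> \<beta>" by blast
      show ?thesis
      proof (intro max_connected_subsetsI sub \<gamma>(2))
        fix \<gamma>' assume *: "\<gamma>' \<subseteq> \<alpha> \<union> \<beta>" "connected_set E \<gamma>'" "\<gamma> \<subseteq> \<gamma>'"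
        have "\<gamma>' \<subseteq> \<beta>" using split[OF *(2,1)] split[OF \<gamma>(2) sub] *(3) \<gamma>(1) by auto
        then show "\<gamma>' = \<gamma>" using * by (intro \<gamma>(3))
      qed
    qed
  qed
qed

section \<open>Chain components and the acyclic digraph \<open>D\<close>\<close>

locale chain_graph_components =
  fixes V :: "'v set" and E :: "('v \<times> 'v) set"
  assumes chain_graph: "chain_graph V E"
begin

abbreviation "comps \<equiv> chain_components V E"
abbreviation "pa \<equiv> pa_D V E"
abbreviation "nd \<equiv> nd_D V E"

lemma finite_V: "finite V" and edges_subset: "E \<subseteq> V \<times> V"
  using chain_graph unfolding chain_graph_def graph_def by auto

text \<open>A return path, shortened to distinct vertices, would be closed by the directed edge to a
  semi-directed cycle.\<close>

lemma directed_edge_no_return: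
  assumes "(u, v) \<in> directed_edges E"
  shows "(v, u) \<notin> E\<^sup>*"
proof
  assume "(v, u) \<in> E\<^sup>*"
  from distinct_walk[OF this] obtain vs where vs: "vs \<noteq> []" "hd vs = v" "last vs = u"
    "distinct vs" "successively (\<lambda>a b. (a, b) \<in> E) vs" by (elim exE conjE)
  let ?n = "length vs"
  have n: "?n > 0" using vs by simp
  \<comment> \<open>The index that wraps around modulo the length is the closing edge, which is the
    given directed edge \<open>(u, v)\<close>.\<close>
  have wrap: "vs ! (?n - 1) = u" "vs ! (Suc (?n - 1) mod ?n) = v"
  proof -
    show "vs ! (?n - 1) = u" using vs(3) last_conv_nth[OF vs(1)] by simp
    have "Suc (?n - 1) = ?n" using n by linarith
    then show "vs ! (Suc (?n - 1) mod ?n) = v"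
      using vs(2) hd_conv_nth[OF vs(1)] by (metis mod_self)
  qed
  have edge: "(vs ! i, vs ! (Suc i mod ?n)) \<in> E" if "i < ?n" for i
  proof (cases "i = ?n - 1")
    case True
    then show ?thesis using wrap assms by (simp only: directed_edges_def mem_Collect_eq case_prod_conv)
  next
    case False
    then show ?thesis using vs(5) that by (auto simp: successively_conv_nth)
  qed
  then have "set vs \<subseteq> V"
    using edges_subset by (fastforce simp: in_set_conv_nth)
  moreover have "\<exists>i<?n. (vs ! i, vs ! (Suc i mod ?n)) \<in> directed_edges E"
  proof (intro exI conjI)
    show "?n - 1 < ?n" using n by linarith
    show "(vs ! (?n - 1), vs ! (Suc (?n - 1) mod ?n)) \<in> directed_edges E"
      unfolding wrap by (rule assms)
  qed
  ultimately have "semi_directed_cycle V E vs"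
    using vs edge unfolding semi_directed_cycle_def by blast
  then show False using chain_graph unfolding chain_graph_def by blast
qed

lemma sym_undirected: "sym ((undirected_edges E)\<^sup>*)"
  by (intro sym_rtrancl) (auto simp: sym_def undirected_edges_def)

lemma undirected_rtrancl_subset: "(undirected_edges E)\<^sup>* \<subseteq> E\<^sup>*"
  by (rule rtrancl_mono) (auto simp: undirected_edges_def)

lemma comps_undirected_path:
  assumes "\<tau> \<in> comps" "u \<in> \<tau>" "v \<in> \<tau>"
  shows "(u, v) \<in> (undirected_edges E)\<^sup>*"
proof -
  obtain r where "\<tau> = (undirected_edges E)\<^sup>* `` {r}"
    using assms(1) unfolding chain_components_def by (auto elim: quotientE)
  then show ?thesis using assms symD[OF sym_undirected] by (meson Image_singleton_iff rtrancl_trans)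
qed

lemma comps_path:
  assumes "\<tau> \<in> comps" "u \<in> \<tau>" "v \<in> \<tau>"
  shows "(u, v) \<in> E\<^sup>*"
  using comps_undirected_path[OF assms] undirected_rtrancl_subset by blast

lemma comps_subset: "\<tau> \<in> comps \<Longrightarrow> \<tau> \<subseteq> V"
proof
  fix v assume "\<tau> \<in> comps" "v \<in> \<tau>"
  then obtain r where "r \<in> V" "(r, v) \<in> (undirected_edges E)\<^sup>*"
    unfolding chain_components_def by (auto elim: quotientE)
  then show "v \<in> V"
    using edges_subset by (auto simp: undirected_edges_def elim: rtranclE)
qed

lemma in_comps: "v \<in> V \<Longrightarrow> \<exists>\<tau>\<in>comps. v \<in> \<tau>"
  unfolding chain_components_def by (auto simp: quotient_def)

lemma Union_comps: "\<Union> comps = V"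
  using comps_subset in_comps by blast

lemma finite_comps: "finite comps"
  by (rule finite_subset[of _ "Pow V"]) (use comps_subset finite_V in auto)

lemma finite_subset_comps:
  assumes "\<tau> \<in> comps" "\<delta> \<subseteq> \<tau>"
  shows "finite \<delta>"
  using assms comps_subset finite_V by (meson finite_subset)

lemma comps_nonempty: "\<tau> \<in> comps \<Longrightarrow> \<tau> \<noteq> {}"
  unfolding chain_components_def by (auto elim!: quotientE)

lemma comps_disjoint:
  assumes "\<tau> \<in> comps" "\<tau>' \<in> comps" "\<tau> \<noteq> \<tau>'"
  shows "\<tau> \<inter> \<tau>' = {}"
proof (rule ccontr)
  assume "\<tau> \<inter> \<tau>' \<noteq> {}"
  then obtain v where v: "v \<in> \<tau>" "v \<in> \<tau>'" by blast
  have eq: "\<sigma> = (undirected_edges E)\<^sup>* `` {v}" if \<sigma>: "\<sigma> \<in> comps" "v \<in> \<sigma>" for \<sigma>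
  proof -
    obtain r where r: "\<sigma> = (undirected_edges E)\<^sup>* `` {r}"
      using \<sigma>(1) unfolding chain_components_def by (auto elim: quotientE)
    with \<sigma>(2) have "(r, v) \<in> (undirected_edges E)\<^sup>*" by simp
    with r symD[OF sym_undirected this] show ?thesis by (auto intro: rtrancl_trans)
  qed
  show False using eq[OF assms(1) v(1)] eq[OF assms(2) v(2)] assms(3) by simp
qed

text \<open>An undirected path joins the endpoints, so a directed edge inside a component would have
  a forbidden return path.\<close>

lemma comps_edge_sym:
  assumes "\<tau> \<in> comps" "u \<in> \<tau>" "v \<in> \<tau>" "(u, v) \<in> E"
  shows "(v, u) \<in> E"
  using directed_edge_no_return[of u v] comps_path[of \<tau> v u] assms
  unfolding directed_edges_def by blast

text \<open>Lifts a path of \<open>D\<close> to \<open>G\<close>: paths inside the components bridge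
  arrival and departure vertices. The first directed edge is kept as a witness, since plain
  reachability would not contradict acyclicity.\<close>

lemma component_path:
  assumes "(\<tau>, \<tau>') \<in> (component_edges V E)\<^sup>+" "u \<in> \<tau>" "v \<in> \<tau>'"
  shows "\<exists>a b. (a, b) \<in> directed_edges E \<and> (u, a) \<in> E\<^sup>* \<and> (b, v) \<in> E\<^sup>*"
  using assms
proof (induction arbitrary: v rule: trancl_induct)
  case (base \<tau>')
  then show ?case unfolding component_edges_def using comps_path by blast
next
  case (step \<tau>1 \<tau>2)
  then obtain x y where xy: "x \<in> \<tau>1" "y \<in> \<tau>2" "(x, y) \<in> directed_edges E" "\<tau>2 \<in> comps"
    unfolding component_edges_def by blast
  obtain a b where "(a, b) \<in> directed_edges E" "(u, a) \<in> E\<^sup>*" "(b, x) \<in> E\<^sup>*"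
    using step.IH[OF step.prems(1) xy(1)] by blast
  moreover have "(x, y) \<in> E" using xy unfolding directed_edges_def by blast
  moreover have "(y, v) \<in> E\<^sup>*" using comps_path xy step.prems by blast
  ultimately show ?case by (meson rtrancl.rtrancl_into_rtrancl rtrancl_trans)
qed

lemma acyclic_component_edges: "acyclic (component_edges V E)"
proof (rule acyclicI, rule allI, rule notI)
  fix \<tau> assume c: "(\<tau>, \<tau>) \<in> (component_edges V E)\<^sup>+"
  then have "\<tau> \<in> comps"
    by (cases rule: tranclE) (auto simp: component_edges_def)
  then obtain v where "v \<in> \<tau>" using comps_nonempty by blast
  then obtain a b where "(a, b) \<in> directed_edges E" "(v, a) \<in> E\<^sup>*" "(b, v) \<in> E\<^sup>*"
    using component_path[OF c] by blast
  then show False using directed_edge_no_return by (meson rtrancl_trans)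
qed

lemma finite_component_edges: "finite (component_edges V E)"
  by (rule finite_subset[of _ "comps \<times> comps"])
    (use finite_comps in \<open>auto simp: component_edges_def\<close>)

text \<open>Supplies a component that can be removed from a parent-closed family: no remaining
  member has it as a parent.\<close>

lemma ex_sink:
  assumes "S \<subseteq> comps" "S \<noteq> {}"
  shows "\<exists>\<tau>\<in>S. \<forall>\<tau>'\<in>S. (\<tau>, \<tau>') \<notin> component_edges V E"
proof -
  have "wf ((component_edges V E)\<inverse>)"
    using finite_component_edges acyclic_component_edges by (rule finite_acyclic_wf_converse)
  then show ?thesis using assms(2) by (metis wfE_min' converse_iff)
qed

text \<open>Meant for the complement of a parent-closed family: a source there has all its parents
  inside the family and can be adjoined to it.\<close>

lemma ex_source:
  assumes "S \<subseteq> comps" "S \<noteq> {}"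
  shows "\<exists>\<tau>\<in>S. \<forall>\<tau>'\<in>S. (\<tau>', \<tau>) \<notin> component_edges V E"
proof -
  have "wf (component_edges V E)"
    using finite_component_edges acyclic_component_edges by (rule finite_acyclic_wf)
  then show ?thesis using assms(2) by (metis wfE_min')
qed

text \<open>A parent of \<tau> that descends from \<tau> would close a cycle in
  \<open>D\<close>.\<close>

lemma pa_subset_nd: "pa \<tau> \<subseteq> nd \<tau>"
proof
  fix v assume "v \<in> pa \<tau>"
  then obtain \<tau>' where t: "(\<tau>', \<tau>) \<in> component_edges V E" "v \<in> \<tau>'" unfolding pa_D_def by blast
  have "(\<tau>, \<tau>') \<notin> (component_edges V E)\<^sup>+"
    using t(1) acyclic_component_edges unfolding acyclic_def by (meson trancl.trancl_into_trancl)
  moreover have "\<tau>' \<noteq> \<tau>" "\<tau>' \<in> comps"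
    using t(1) acyclic_component_edges unfolding acyclic_def component_edges_def by blast+
  ultimately show "v \<in> nd \<tau>" using t(2) unfolding nd_D_def by blast
qed

lemma nd_disjoint: "\<tau> \<in> comps \<Longrightarrow> \<tau> \<inter> nd \<tau> = {}"
  unfolding nd_D_def using comps_disjoint by blast

lemma nd_subset: "nd \<tau> \<subseteq> V"
  unfolding nd_D_def using comps_subset by blast

lemma pa_subset: "pa \<tau> \<subseteq> V"
  using pa_subset_nd nd_subset by blast

lemma pa_disjoint: "\<tau> \<in> comps \<Longrightarrow> \<tau> \<inter> pa \<tau> = {}"
  using nd_disjoint pa_subset_nd by blast

lemma parents_subset_pa:
  assumes "\<tau> \<in> comps" "v \<in> \<tau>"
  shows "parents E v \<subseteq> pa \<tau>"
proof
  fix u assume "u \<in> parents E v"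
  then have uv: "(u, v) \<in> directed_edges E" unfolding parents_def by simp
  then obtain \<tau>' where "\<tau>' \<in> comps" "u \<in> \<tau>'"
    using edges_subset in_comps unfolding directed_edges_def by blast
  with uv assms show "u \<in> pa \<tau>" unfolding pa_D_def component_edges_def by blast
qed

lemma pa_G_subset_pa: "\<tau> \<in> comps \<Longrightarrow> \<sigma> \<subseteq> \<tau> \<Longrightarrow> pa_G E \<sigma> \<subseteq> pa \<tau>"
  unfolding pa_G_def using parents_subset_pa by blast

text \<open>Not automatic, since \<open>pa_G\<close> removes the set itself. Inside a component
  nothing is lost by this, because parents of its vertices lie in \<open>pa \<tau>\<close>, which is
  disjoint from \<tau>.\<close>

lemma pa_G_mono:
  assumes "\<tau> \<in> comps" "\<sigma> \<subseteq> \<tau>" "\<sigma>' \<subseteq> \<sigma>"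
  shows "pa_G E \<sigma>' \<subseteq> pa_G E \<sigma>"
  unfolding pa_G_def using parents_subset_pa[OF assms(1)] pa_disjoint[OF assms(1)] assms by blast

text \<open>\<open>Nb_G\<close> accounts for undirected edges only, but inside a component there are
  no others.\<close>

lemma Nb_separated:
  assumes "\<tau> \<in> comps" "\<sigma> \<subseteq> \<tau>" "u \<in> \<sigma>" "v \<in> \<tau> - Nb_G E \<sigma>"
  shows "(u, v) \<notin> E" "(v, u) \<notin> E"
  using assms comps_edge_sym[OF assms(1)]
  unfolding Nb_G_def nb_G_def neighbors_def undirected_edges_def by blast+

lemma Nb_separatedI:
  assumes "\<beta> \<subseteq> \<tau>" "\<And>u v. u \<in> \<sigma> \<Longrightarrow> v \<in> \<beta> \<Longrightarrow> u \<noteq> v \<and> (u, v) \<notin> E \<and> (v, u) \<notin> E"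
  shows "\<beta> \<subseteq> \<tau> - Nb_G E \<sigma>"
  using assms unfolding Nb_G_def nb_G_def neighbors_def undirected_edges_def by blast

end


section \<open>Positive random vectors\<close>

text \<open>The event that the subvectors of \<open>X\<close> and \<open>i\<close> indexed by
  \<open>A\<close> coincide. Values of \<open>i\<close> off \<open>A\<close> are ignored, which is
  what allows \<open>i\<close> to be any total function.\<close>

definition agree :: "'v set \<Rightarrow> ('v \<Rightarrow> nat) \<Rightarrow> ('v \<Rightarrow> nat) set" where
  "agree A i = {x. \<forall>v\<in>A. x v = i v}"

lemma agree_Un: "agree (A \<union> B) i = agree A i \<inter> agree B i"
  by (auto simp: agree_def)

lemma agree_empty [simp]: "agree {} i = UNIV"
  by (simp add: agree_def)

lemma agree_cong: "(\<And>v. v \<in> A \<Longrightarrow> i v = j v) \<Longrightarrow> agree A i = agree A j"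
  by (auto simp: agree_def)

lemma restrict_eq_iff_agree: "restrict x A = restrict i A \<longleftrightarrow> x \<in> agree A i"
  by (auto simp: agree_def restrict_def fun_eq_iff)

lemma agree_override_subset: "B \<subseteq> A \<Longrightarrow> agree B (override_on i k A) = agree B k"
  by (rule agree_cong) (auto simp: override_on_def)

lemma agree_override_disjoint: "A \<inter> B = {} \<Longrightarrow> agree B (override_on i k A) = agree B i"
  by (rule agree_cong) (auto simp: override_on_def)

text \<open>Inclusion-exclusion: a coordinate with the top value \<open>d v\<close> is eliminated by subtracting
  the other values from the marginal without that coordinate.\<close>

lemma eq_on_states_if_eq_on_reduced:
  fixes f g :: "'v set \<Rightarrow> ('v \<Rightarrow> nat) \<Rightarrow> real"
  assumes f: "\<And>A v j. insert v A \<subseteq> U \<Longrightarrow> v \<notin> A \<Longrightarrow> f A j = (\<Sum>l\<in>{1..d v}. f (insert v A) (j(v := l)))"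
    and g: "\<And>A v j. insert v A \<subseteq> U \<Longrightarrow> v \<notin> A \<Longrightarrow> g A j = (\<Sum>l\<in>{1..d v}. g (insert v A) (j(v := l)))"
    and reduced: "\<And>A j. A \<subseteq> U \<Longrightarrow> (\<forall>v\<in>A. j v \<in> {1..<d v}) \<Longrightarrow> f A j = g A j"
    and "finite A" "A \<subseteq> U" "\<forall>v\<in>A. j v \<in> {1..d v}"
  shows "f A j = g A j"
  using assms(4-6)
\<comment> \<open>The number of top values drops in both uses of the induction hypothesis: when
  \<open>v\<close> leaves \<open>A\<close>, and when its value is lowered with \<open>A\<close>
  unchanged.\<close>
proof (induction "card {v \<in> A. j v = d v}" arbitrary: A j rule: less_induct)
  case less
  show ?case
  proof (cases "\<exists>v\<in>A. j v = d v")
    case False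
    then have "\<forall>v\<in>A. j v \<in> {1..<d v}" using less.prems(3) by fastforce
    then show ?thesis using reduced less.prems by blast
  next
    case True
    then obtain v where v: "v \<in> A" "j v = d v" by blast
    define B where "B = A - {v}"
    have B: "insert v B = A" "v \<notin> B" "insert v B \<subseteq> U" "finite B" "B \<subseteq> U" "\<forall>w\<in>B. j w \<in> {1..d w}"
      using v less.prems by (auto simp: B_def)
    have j: "j(v := d v) = j" using v(2) by auto
    have top: "d v \<in> {1..d v}" using less.prems(3) v by fastforce
    have fin: "finite {w \<in> A. j w = d w}" using less.prems(1) by simp
    have "{w \<in> B. j w = d w} \<subset> {w \<in> A. j w = d w}" using v by (auto simp: B_def)
    then have B_eq: "f B j = g B j"
      using less.hyps[of B j] B psubset_card_mono[OF fin] by blast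
    have l_eq: "f A (j(v := l)) = g A (j(v := l))" if l: "l \<in> {1..d v} - {d v}" for l
    proof (rule less.hyps)
      have "{w \<in> A. (j(v := l)) w = d w} \<subset> {w \<in> A. j w = d w}" using v l by auto
      then show "card {w \<in> A. (j(v := l)) w = d w} < card {w \<in> A. j w = d w}"
        by (rule psubset_card_mono[OF fin])
    qed (use less.prems l in auto)
    \<comment> \<open>The summation rule for \<open>v\<close> with the term \<open>l = d v\<close>
      split off; that term is the wanted one, and everything else is already known to agree for
      \<open>f\<close> and \<open>g\<close>.\<close>
    have "f B j = f A j + (\<Sum>l\<in>{1..d v} - {d v}. f A (j(v := l)))"
      using f[OF B(3,2), of j] by (simp add: B(1) j sum.remove[OF _ top] del: One_nat_def)
    moreover have "g B j = g A j + (\<Sum>l\<in>{1..d v} - {d v}. g A (j(v := l)))"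
      using g[OF B(3,2), of j] by (simp add: B(1) j sum.remove[OF _ top] del: One_nat_def)
    moreover have "(\<Sum>l\<in>{1..d v} - {d v}. f A (j(v := l))) = (\<Sum>l\<in>{1..d v} - {d v}. g A (j(v := l)))"
      by (rule sum.cong) (use l_eq in auto)
    ultimately show ?thesis using B_eq by linarith
  qed
qed

section \<open>Conditional probabilities under a strictly positive distribution\<close>

locale positive_random_vector =
  fixes V :: "'v set" and d :: "'v \<Rightarrow> nat" and p :: "('v \<Rightarrow> nat) pmf"
  assumes finite_index: "finite V" and interior: "p \<in> prob_simplex_interior V d"
begin

abbreviation "P \<equiv> measure_pmf.prob p"

text \<open>Counterpart of \<open>cprob\<close> for total vectors; \<open>cprob\<close> gives zero
  on vectors that are not \<open>undefined\<close> off their index set. A null conditioning event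
  yields the default value 0.\<close>

definition cpr :: "'v set \<Rightarrow> ('v \<Rightarrow> nat) \<Rightarrow> 'v set \<Rightarrow> ('v \<Rightarrow> nat) \<Rightarrow> real" where
  "cpr A j B i = P (agree A j \<inter> agree B i) / P (agree B i)"

lemma cprob_eq_cpr: "cprob p A (restrict j A) B (restrict i B) = cpr A j B i"
  by (simp add: cprob_def cpr_def cond_prob_def restrict_eq_iff_agree Int_def)

lemma cpr_cong:
  "(\<And>v. v \<in> A \<Longrightarrow> j v = j' v) \<Longrightarrow> (\<And>v. v \<in> B \<Longrightarrow> i v = i' v) \<Longrightarrow> cpr A j B i = cpr A j' B i'"
  unfolding cpr_def using agree_cong[of A j j'] agree_cong[of B i i'] by simp

lemma set_pmf_eq: "set_pmf p = states d V"
  using interior unfolding prob_simplex_interior_def prob_simplex_def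
  by (auto simp: set_pmf_iff)

lemma finite_states: "A \<subseteq> V \<Longrightarrow> finite (states d A)"
  unfolding states_def using finite_index by (intro finite_PiE) (auto intro: finite_subset)

text \<open>An in-range partial vector extends to a full state by overriding some state, and full
  states have positive mass. A state exists because the support of a pmf is nonempty.\<close>

lemma prob_pos_iff:
  assumes "A \<subseteq> V"
  shows "P (agree A i) > 0 \<longleftrightarrow> (\<forall>v\<in>A. i v \<in> {1..d v})"
proof
  assume "P (agree A i) > 0"
  then have "states d V \<inter> agree A i \<noteq> {}"
    using measure_pmf_zero_iff[of p "agree A i"] set_pmf_eq by fastforce
  then obtain x where "x \<in> states d V" "x \<in> agree A i" by blast
  then show "\<forall>v\<in>A. i v \<in> {1..d v}"
    using assms unfolding states_def agree_def by (fastforce dest: PiE_mem)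
next
  assume i: "\<forall>v\<in>A. i v \<in> {1..d v}"
  obtain s where "s \<in> states d V" using set_pmf_not_empty[of p] set_pmf_eq by blast
  then have "override_on s i A \<in> states d V"
    using i assms unfolding states_def PiE_def extensional_def override_on_def by auto
  moreover have "override_on s i A \<in> agree A i" by (simp add: agree_def override_on_def)
  ultimately show "P (agree A i) > 0" using measure_pmf_posI set_pmf_eq by metis
qed

lemma prob_pos_mono: "B \<subseteq> A \<Longrightarrow> A \<subseteq> V \<Longrightarrow> P (agree A i) > 0 \<Longrightarrow> P (agree B i) > 0"
  using prob_pos_iff[of A i] prob_pos_iff[of B i] by blast

lemma prob_pos_states:
  assumes "A \<subseteq> V" "i \<in> states d A"
  shows "P (agree A i) > 0"
  using assms prob_pos_iff[of A i] unfolding states_def by blast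

lemma restrict_mem_states:
  assumes "A \<subseteq> V" "P (agree A i) > 0"
  shows "restrict i A \<in> states d A"
  using assms prob_pos_iff[of A i] unfolding states_def by auto

lemma prob_eq_0I: "P B = 0 \<Longrightarrow> A \<subseteq> B \<Longrightarrow> P A = 0"
  using measure_pmf.finite_measure_mono[of A B p] by (simp add: measure_le_0_iff)

lemma prob_partition:
  assumes "finite F" "\<And>x. x \<in> states d V \<Longrightarrow> f x \<in> F"
  shows "P S = (\<Sum>k\<in>F. P (S \<inter> {x. f x = k}))"
proof -
  have "P S = P (\<Union>k\<in>F. S \<inter> {x. f x = k})"
    by (rule measure_pmf.finite_measure_eq_AE) (auto intro!: AE_pmfI simp: set_pmf_eq assms)
  also have "\<dots> = (\<Sum>k\<in>F. P (S \<inter> {x. f x = k}))"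
    by (rule measure_pmf.finite_measure_finite_Union)
      (auto simp: assms disjoint_family_on_def)
  finally show ?thesis .
qed

lemma prob_sum_states:
  assumes "A \<subseteq> V"
  shows "P S = (\<Sum>k\<in>states d A. P (S \<inter> agree A k))"
proof -
  have "P S = (\<Sum>k\<in>states d A. P (S \<inter> {x. restrict x A = k}))"
    by (rule prob_partition[OF finite_states[OF assms]])
      (use assms in \<open>auto simp: states_def\<close>)
  also have "\<dots> = (\<Sum>k\<in>states d A. P (S \<inter> agree A k))"
  proof (rule sum.cong[OF refl])
    fix k assume "k \<in> states d A"
    then have "k = restrict k A" unfolding states_def by (auto simp: PiE_restrict)
    then have "restrict x A = k \<longleftrightarrow> x \<in> agree A k" for x by (metis restrict_eq_iff_agree)
    then show "P (S \<inter> {x. restrict x A = k}) = P (S \<inter> agree A k)" by (simp add: Int_def)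
  qed
  finally show ?thesis .
qed

lemma cpr_sum_states:
  assumes "B \<subseteq> V" "A \<inter> B = {}"
  shows "cpr A j C i = (\<Sum>k\<in>states d B. cpr (A \<union> B) (override_on j k B) C i)"
proof -
  have "agree (A \<union> B) (override_on j k B) = agree A j \<inter> agree B k" for k
    using assms(2) by (simp add: agree_Un agree_override_subset agree_override_disjoint Int_commute)
  then have "(\<Sum>k\<in>states d B. cpr (A \<union> B) (override_on j k B) C i) =
      (\<Sum>k\<in>states d B. P (agree A j \<inter> agree C i \<inter> agree B k)) / P (agree C i)"
    by (simp add: cpr_def sum_divide_distrib Int_ac)
  then show ?thesis
    using prob_sum_states[OF assms(1), of "agree A j \<inter> agree C i"] by (simp add: cpr_def)
qed

text \<open>The one-coordinate summation rule in the form that the comparison on reduced states asks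
  for.\<close>

lemma cpr_sum_coordinate:
  assumes "v \<in> V" "v \<notin> A"
  shows "cpr A j C i = (\<Sum>l\<in>{1..d v}. cpr (insert v A) (j(v := l)) C i)"
proof -
  have *: "agree (insert v A) (j(v := l)) = agree A j \<inter> {x. x v = l}" for l
    using assms(2) by (auto simp: agree_def)
  have "P (agree A j \<inter> agree C i) = (\<Sum>l\<in>{1..d v}. P (agree A j \<inter> agree C i \<inter> {x. x v = l}))"
    by (rule prob_partition) (use assms(1) in \<open>auto simp: states_def dest!: PiE_mem\<close>)
  then show ?thesis by (simp add: cpr_def * sum_divide_distrib Int_ac)
qed

lemma cpr_empty: "P (agree C i) > 0 \<Longrightarrow> cpr {} j C i = 1"
  by (simp add: cpr_def)

lemma sum_cpr_eq_1:
  assumes "B \<subseteq> V" "P (agree C i) > 0"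
  shows "(\<Sum>k\<in>states d B. cpr B k C i) = 1"
proof -
  have "(\<Sum>k\<in>states d B. cpr B k C i) = (\<Sum>k\<in>states d B. cpr ({} \<union> B) (override_on k k B) C i)"
    by (rule sum.cong) (auto simp: override_on_def intro: cpr_cong)
  moreover have "(\<Sum>k\<in>states d B. cpr ({} \<union> B) (override_on k k B) C i)
      = (\<Sum>k\<in>states d B. cpr ({} \<union> B) (override_on i k B) C i)"
    by (rule sum.cong) (auto simp: override_on_def intro: cpr_cong)
  ultimately show ?thesis
    using cpr_sum_states[OF assms(1), of "{}" i C i] cpr_empty[OF assms(2)] by simp
qed

text \<open>Identities are stated for all total vectors; this disposes of those with a value out of
  range.\<close>

lemma cpr_eq_0: "A \<subseteq> V \<Longrightarrow> \<exists>v\<in>A. j v \<notin> {1..d v} \<Longrightarrow> cpr A j C i = 0"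
proof -
  assume "A \<subseteq> V" "\<exists>v\<in>A. j v \<notin> {1..d v}"
  then have "P (agree A j) = 0" using prob_pos_iff[of A j] by (metis zero_less_measure_iff)
  then show ?thesis unfolding cpr_def by (simp add: prob_eq_0I)
qed

section \<open>Conditional independence as equations between conditional probabilities\<close>

lemma cond_indep_iff:
  assumes "\<alpha> \<inter> \<beta> = {}"
  shows "cond_indep p \<alpha> \<beta> \<gamma> \<longleftrightarrow>
    (\<forall>j i. P (agree \<gamma> i) > 0 \<longrightarrow> cpr (\<alpha> \<union> \<beta>) j \<gamma> i = cpr \<alpha> j \<gamma> i * cpr \<beta> j \<gamma> i)"
    (is "?L \<longleftrightarrow> ?R")
proof
  assume L: ?L
  show ?R
  proof (intro allI impI)
    fix j i assume pos: "P (agree \<gamma> i) > 0"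
    have pos': "\<P>(x in measure_pmf p. restrict x \<gamma> = restrict i \<gamma>) > 0"
      using pos by (simp add: restrict_eq_iff_agree)
    have "\<P>(x in measure_pmf p. restrict x \<alpha> = restrict j \<alpha> \<and> restrict x \<beta> = restrict j \<beta> \<bar>
          restrict x \<gamma> = restrict i \<gamma>) =
        cprob p \<alpha> (restrict j \<alpha>) \<gamma> (restrict i \<gamma>) * cprob p \<beta> (restrict j \<beta>) \<gamma> (restrict i \<gamma>)"
      using L[unfolded cond_indep_def, rule_format, OF pos'] .
    then show "cpr (\<alpha> \<union> \<beta>) j \<gamma> i = cpr \<alpha> j \<gamma> i * cpr \<beta> j \<gamma> i"
      unfolding cprob_eq_cpr
      by (simp add: cpr_def cond_prob_def restrict_eq_iff_agree agree_Un Int_def conj_ac)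
  qed
next
  assume R: ?R
  show ?L unfolding cond_indep_def
  proof (intro allI impI)
    fix a b c assume pos: "\<P>(x in measure_pmf p. restrict x \<gamma> = c) > 0"
    \<comment> \<open>An event of positive probability is nonempty, so \<open>c\<close> is a
      restriction to \<gamma>.\<close>
    then have "{x. restrict x \<gamma> = c} \<noteq> {}" by force
    then have c: "c = restrict c \<gamma>" by auto
    then have mem_c: "restrict x \<gamma> = c \<longleftrightarrow> x \<in> agree \<gamma> c" for x by (metis restrict_eq_iff_agree)
    show "\<P>(x in measure_pmf p. restrict x \<alpha> = a \<and> restrict x \<beta> = b \<bar> restrict x \<gamma> = c) =
        cprob p \<alpha> a \<gamma> c * cprob p \<beta> b \<gamma> c"
    proof (cases "a = restrict a \<alpha> \<and> b = restrict b \<beta>")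
      case True
      \<comment> \<open>Disjointness of \<alpha> and \<beta> lets a single vector carry both
        \<open>a\<close> and \<open>b\<close>.\<close>
      let ?j = "override_on b a \<alpha>"
      have a: "a = restrict ?j \<alpha>"
        using True by (metis agree_override_subset order_refl restrict_eq_iff_agree)
      have b: "b = restrict ?j \<beta>"
        using True assms by (metis agree_override_disjoint restrict_eq_iff_agree)
      have "P (agree \<gamma> c) > 0"
        using pos by (simp add: mem_c)
      then have *: "cpr (\<alpha> \<union> \<beta>) ?j \<gamma> c = cpr \<alpha> ?j \<gamma> c * cpr \<beta> ?j \<gamma> c" using R by blast
      have "\<P>(x in measure_pmf p. restrict x \<alpha> = restrict ?j \<alpha> \<and> restrict x \<beta> = restrict ?j \<beta> \<bar>
          restrict x \<gamma> = restrict c \<gamma>) = cpr (\<alpha> \<union> \<beta>) ?j \<gamma> c"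
        by (simp add: cpr_def cond_prob_def restrict_eq_iff_agree agree_Un Int_def conj_ac)
      with * show ?thesis
        unfolding cprob_eq_cpr[symmetric] a[symmetric] b[symmetric] c[symmetric] by simp
    next
      case False
      \<comment> \<open>One of the two events is empty, so both sides vanish.\<close>
      then have "(\<forall>x. restrict x \<alpha> \<noteq> a) \<or> (\<forall>x. restrict x \<beta> \<noteq> b)" by force
      then show ?thesis by (auto simp: cprob_def cond_prob_def)
    qed
  qed
qed

text \<open>Law of total probability: conditioning on the coarser \<open>U\<close> averages the
  values given \<open>D\<close>, all of which equal \<open>h\<close>. Null configurations on
  \<open>D - U\<close> contribute nothing to either side.\<close>

lemma cpr_average:
  assumes sub: "U \<subseteq> D" "D \<subseteq> V"
    and h: "\<And>k. P (agree D k) > 0 \<Longrightarrow> (\<And>v. v \<in> U \<Longrightarrow> k v = i v) \<Longrightarrow> cpr \<alpha> j D k = h"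
    and pos: "P (agree U i) > 0"
  shows "cpr \<alpha> j U i = h"
proof -
  define W where "W = D - U"
  have W: "W \<subseteq> V" "D = U \<union> W" "W \<inter> U = {}" using sub by (auto simp: W_def)
  have split: "agree U i \<inter> agree W k = agree D (override_on i k W)" for k
    using W(3) by (simp add: W(2) agree_Un agree_override_subset agree_override_disjoint)
  have summand: "P (agree \<alpha> j \<inter> agree U i \<inter> agree W k) = h * P (agree U i \<inter> agree W k)" for k
  proof (cases "P (agree D (override_on i k W)) > 0")
    case True
    have "cpr \<alpha> j D (override_on i k W) = h"
      by (rule h[OF True]) (use W(3) in \<open>auto simp: override_on_def\<close>)
    then show ?thesis
      using True by (simp add: cpr_def split Int_assoc field_simps)
  next
    case False
    then have "P (agree D (override_on i k W)) = 0" by (metis zero_less_measure_iff)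
    then show ?thesis by (simp add: split Int_assoc prob_eq_0I)
  qed
  have "P (agree \<alpha> j \<inter> agree U i) = h * P (agree U i)"
    unfolding prob_sum_states[OF W(1), of "agree \<alpha> j \<inter> agree U i"]
      prob_sum_states[OF W(1), of "agree U i"] summand by (simp add: sum_distrib_left)
  then show ?thesis using pos by (simp add: cpr_def)
qed

text \<open>Given \<open>G\<close>, knowing the rest of \<open>D\<close> does not change the law of
  \<alpha>. This form covers (C1), with \<open>D = nd \<tau>\<close> and
  \<open>G = pa \<tau>\<close>, as well as (C3b), with \<open>D = pa \<tau>\<close> and
  \<open>G = pa_G E \<sigma>\<close>.\<close>

lemma cond_indep_iff_conditioning:
  assumes "\<alpha> \<inter> D = {}" "G \<subseteq> D" "D \<subseteq> V"
  shows "cond_indep p \<alpha> (D - G) G \<longleftrightarrow>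
    (\<forall>j i. P (agree D i) > 0 \<longrightarrow> cpr \<alpha> j D i = cpr \<alpha> j G i)"
proof -
  have disj: "\<alpha> \<inter> (D - G) = {}" using assms by blast
  have D: "agree (D - G) i \<inter> agree G i = agree D i" for i
    using assms(2) agree_Un[of "D - G" G i] by (simp add: Un_absorb2)
  \<comment> \<open>When \<open>i\<close> and \<open>j\<close> agree on \<open>D - G\<close>, the
    two identities differ only by clearing positive denominators.\<close>
  have eq: "cpr (\<alpha> \<union> (D - G)) j G i = cpr \<alpha> j G i * cpr (D - G) j G i \<longleftrightarrow> cpr \<alpha> j D i = cpr \<alpha> j G i"
    if i: "P (agree D i) > 0" "\<And>v. v \<in> D - G \<Longrightarrow> i v = j v" for i j
  proof -
    have a: "agree (D - G) j = agree (D - G) i" using i(2) by (intro agree_cong) simp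
    have G: "P (agree G i) > 0" using prob_pos_mono[OF assms(2,3) i(1)] .
    show ?thesis
      using i(1) G by (simp add: cpr_def agree_Un a Int_assoc D field_simps)
  qed
  show ?thesis unfolding cond_indep_iff[OF disj]
  proof (intro iffI allI impI)
    fix j i
    assume *: "\<forall>j i. P (agree G i) > 0 \<longrightarrow>
        cpr (\<alpha> \<union> (D - G)) j G i = cpr \<alpha> j G i * cpr (D - G) j G i"
      and pos: "P (agree D i) > 0"
    \<comment> \<open>\<open>j\<close> may disagree with \<open>i\<close> on \<open>D - G\<close>;
      only its values on \<alpha> matter, so the rest is taken from \<open>i\<close>.\<close>
    let ?j = "override_on i j \<alpha>"
    have "cpr \<alpha> ?j D i = cpr \<alpha> ?j G i"
    proof (rule iffD1[OF eq[OF pos]])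
      show "i v = ?j v" if "v \<in> D - G" for v using that disj by (auto simp: override_on_def)
    qed (use * prob_pos_mono[OF assms(2,3) pos] in blast)
    then show "cpr \<alpha> j D i = cpr \<alpha> j G i" by (simp add: cpr_def agree_override_subset)
  next
    fix j i
    assume *: "\<forall>j i. P (agree D i) > 0 \<longrightarrow> cpr \<alpha> j D i = cpr \<alpha> j G i"
      and pos: "P (agree G i) > 0"
    \<comment> \<open>Here the conditioning vector is adapted instead: it keeps \<open>i\<close> on
      \<open>G\<close> and reads \<open>j\<close> on \<open>D - G\<close>.\<close>
    let ?i = "override_on j i G"
    have G: "agree G ?i = agree G i" and DG: "agree (D - G) ?i = agree (D - G) j"
      by (auto simp: agree_override_subset agree_override_disjoint)
    show "cpr (\<alpha> \<union> (D - G)) j G i = cpr \<alpha> j G i * cpr (D - G) j G i"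
    proof (cases "P (agree D ?i) > 0")
      case True
      have "cpr (\<alpha> \<union> (D - G)) j G ?i = cpr \<alpha> j G ?i * cpr (D - G) j G ?i"
      proof (rule iffD2[OF eq[OF True]])
        show "?i v = j v" if "v \<in> D - G" for v using that by (auto simp: override_on_def)
      qed (use * True in blast)
      then show ?thesis by (simp add: cpr_def G)
    next
      case False
      then have 0: "P (agree (D - G) j \<inter> agree G i) = 0"
        using D[of ?i] G DG by (metis zero_less_measure_iff)
      then have "P (agree \<alpha> j \<inter> (agree (D - G) j \<inter> agree G i)) = 0"
        by (rule prob_eq_0I) blast
      with 0 show ?thesis by (simp add: cpr_def agree_Un Int_assoc)
    qed
  qed
qed

end


section \<open>The type IV Markov property\<close>

locale chain_graph_model =
  chain_graph_components V E + positive_random_vector V d p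
  for V :: "'v set" and E :: "('v \<times> 'v) set" and d :: "'v \<Rightarrow> nat" and p :: "('v \<Rightarrow> nat) pmf"
begin

section \<open>Factorization over ancestral families and (C1)\<close>

definition parent_closed :: "'v set set \<Rightarrow> bool" where
  "parent_closed S \<longleftrightarrow> S \<subseteq> comps \<and> (\<forall>\<tau>\<in>S. \<forall>\<tau>'. (\<tau>', \<tau>) \<in> component_edges V E \<longrightarrow> \<tau>' \<in> S)"

lemma parent_closedD:
  assumes "parent_closed S"
  shows "S \<subseteq> comps" "finite S" "\<Union>S \<subseteq> V" "\<And>\<tau>. \<tau> \<in> S \<Longrightarrow> pa \<tau> \<subseteq> \<Union>S"
proof -
  show "S \<subseteq> comps" using assms unfolding parent_closed_def by blast
  then show "finite S" "\<Union>S \<subseteq> V" using finite_comps comps_subset by (auto intro: finite_subset)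
  show "pa \<tau> \<subseteq> \<Union>S" if "\<tau> \<in> S" for \<tau> using assms that unfolding parent_closed_def pa_D_def by blast
qed

lemma parent_closed_ancestor:
  assumes "parent_closed S" "(\<tau>, \<tau>') \<in> (component_edges V E)\<^sup>*" "\<tau>' \<in> S"
  shows "\<tau> \<in> S"
  using assms(2,3)
  by (induction rule: converse_rtrancl_induct) (use assms(1) in \<open>auto simp: parent_closed_def\<close>)

lemma pa_subset_Union_Diff:
  assumes "parent_closed S" "\<tau> \<in> S"
  shows "pa \<tau> \<subseteq> \<Union>(S - {\<tau>})"
proof -
  have "(\<tau>, \<tau>) \<notin> component_edges V E"
    using acyclic_component_edges unfolding acyclic_def by blast
  then show ?thesis using assms unfolding parent_closed_def pa_D_def by blast
qed

lemma prob_factorization_of_local_Markov: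
  assumes markov: "\<And>\<tau> j i. \<tau> \<in> comps \<Longrightarrow> P (agree (nd \<tau>) i) > 0 \<Longrightarrow> cpr \<tau> j (nd \<tau>) i = cpr \<tau> j (pa \<tau>) i"
    and "parent_closed S" "P (agree (\<Union>S) i) > 0"
  shows "P (agree (\<Union>S) i) = (\<Prod>\<tau>\<in>S. cpr \<tau> i (pa \<tau>) i)"
  using assms(2,3)
proof (induction "card S" arbitrary: S rule: less_induct)
  case less
  note S = parent_closedD[OF less.prems(1)]
  show ?case
  proof (cases "S = {}")
    case False
    then obtain \<tau> where \<tau>: "\<tau> \<in> S" "\<And>\<tau>'. \<tau>' \<in> S \<Longrightarrow> (\<tau>, \<tau>') \<notin> component_edges V E"
      using ex_sink[OF S(1)] by blast
    define U where "U = \<Union>(S - {\<tau>})"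
    have closed: "parent_closed (S - {\<tau>})"
      using less.prems(1) \<tau>(2) unfolding parent_closed_def by blast
    have "\<Union>S = \<tau> \<union> U" using \<tau>(1) unfolding U_def by blast
    then have S_split: "agree (\<Union>S) i = agree \<tau> i \<inter> agree U i" by (simp add: agree_Un)
    have pa_U: "pa \<tau> \<subseteq> U" unfolding U_def by (rule pa_subset_Union_Diff[OF less.prems(1) \<tau>(1)])
    \<comment> \<open>The first edge of such a path would lead to a child of \<tau>, which belongs
      to \<open>S\<close> as an ancestor of \<open>\<tau>'\<close>; but \<tau> is a sink of
      \<open>S\<close>.\<close>
    have "(\<tau>, \<tau>') \<notin> (component_edges V E)\<^sup>+" if "\<tau>' \<in> S" for \<tau>'
    proof
      assume "(\<tau>, \<tau>') \<in> (component_edges V E)\<^sup>+"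
      then obtain \<sigma> where "(\<tau>, \<sigma>) \<in> component_edges V E" "(\<sigma>, \<tau>') \<in> (component_edges V E)\<^sup>*"
        by (meson tranclD)
      then show False using parent_closed_ancestor[OF less.prems(1)] that \<tau>(2) by blast
    qed
    then have U_nd: "U \<subseteq> nd \<tau>" using S(1) unfolding U_def nd_D_def by blast
    have "U \<subseteq> \<Union>S" unfolding U_def by blast
    then have pos: "P (agree U i) > 0" by (rule prob_pos_mono[OF _ S(3) less.prems(2)])
    \<comment> \<open>The hypothesis conditions on all nondescendants; averaging brings it down to
      \<open>U\<close>, since the value depends on the coordinates in \<open>pa \<tau>\<close> only
      and these lie in \<open>U\<close>.\<close>
    have "cpr \<tau> i U i = cpr \<tau> i (pa \<tau>) i"
    proof (rule cpr_average[OF U_nd nd_subset _ pos])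
      fix k assume k: "P (agree (nd \<tau>) k) > 0" "\<And>v. v \<in> U \<Longrightarrow> k v = i v"
      have "cpr \<tau> i (nd \<tau>) k = cpr \<tau> i (pa \<tau>) k" using markov k(1) \<tau>(1) S(1) by blast
      also have "\<dots> = cpr \<tau> i (pa \<tau>) i" by (rule cpr_cong) (use k(2) pa_U in auto)
      finally show "cpr \<tau> i (nd \<tau>) k = cpr \<tau> i (pa \<tau>) i" .
    qed
    then have "P (agree (\<Union>S) i) = cpr \<tau> i (pa \<tau>) i * P (agree U i)"
      using pos unfolding S_split by (simp add: cpr_def[of \<tau> i U i] field_simps)
    moreover have "P (agree U i) = (\<Prod>\<tau>\<in>S - {\<tau>}. cpr \<tau> i (pa \<tau>) i)"
      unfolding U_def
      by (rule less.hyps[OF card_Diff1_less[OF S(2) \<tau>(1)] closed pos[unfolded U_def]])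
    ultimately show ?thesis by (simp add: prod.remove[OF S(2) \<tau>(1)])
  qed simp
qed

text \<open>Descends from the full family, by induction on the number of missing components. Adjoin
  a source \<tau> of the complement and sum over the states of \<tau>: no other factor reads these
  coordinates, and the factor of \<tau> sums to 1.\<close>

lemma prob_factorization_parent_closed:
  assumes fact: "\<And>i. P (agree V i) > 0 \<Longrightarrow> P (agree V i) = (\<Prod>\<tau>\<in>comps. cpr \<tau> i (pa \<tau>) i)"
    and "parent_closed S" "P (agree (\<Union>S) i) > 0"
  shows "P (agree (\<Union>S) i) = (\<Prod>\<tau>\<in>S. cpr \<tau> i (pa \<tau>) i)"
  using assms(2,3)
proof (induction "card (comps - S)" arbitrary: S i rule: less_induct)
  case less
  note S = parent_closedD[OF less.prems(1)]
  show ?case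
  proof (cases "S = comps")
    case True
    then show ?thesis using fact less.prems(2) Union_comps by simp
  next
    case False
    then have "comps - S \<noteq> {}" using S(1) by blast
    then obtain \<tau> where \<tau>: "\<tau> \<in> comps" "\<tau> \<notin> S"
      "\<And>\<tau>'. \<tau>' \<in> comps \<Longrightarrow> \<tau>' \<notin> S \<Longrightarrow> (\<tau>', \<tau>) \<notin> component_edges V E"
      using ex_source[of "comps - S"] by blast
    have edge_comps: "\<tau>' \<in> comps" if "(\<tau>', \<tau>'') \<in> component_edges V E" for \<tau>' \<tau>''
      using that unfolding component_edges_def by blast
    have closed: "parent_closed (insert \<tau> S)"
      using less.prems(1) \<tau> edge_comps unfolding parent_closed_def by blast
    have "pa \<tau> \<subseteq> \<Union>(insert \<tau> S - {\<tau>})" by (rule pa_subset_Union_Diff[OF closed]) simp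
    then have pa_S: "pa \<tau> \<subseteq> \<Union>S" by blast
    have disj: "\<tau> \<inter> \<Union>S = {}" using comps_disjoint \<tau>(1,2) S(1) by blast
    have \<tau>V: "\<tau> \<subseteq> V" by (rule comps_subset[OF \<tau>(1)])
    have split: "agree (\<Union>(insert \<tau> S)) (override_on i k \<tau>) = agree (\<Union>S) i \<inter> agree \<tau> k" for k
      using disj by (simp add: agree_Un agree_override_subset agree_override_disjoint Int_commute)
    have "P (agree (\<Union>S) i \<inter> agree \<tau> k) = cpr \<tau> k (pa \<tau>) i * (\<Prod>\<tau>\<in>S. cpr \<tau> i (pa \<tau>) i)"
      if k: "k \<in> states d \<tau>" for k
    proof -
      let ?i = "override_on i k \<tau>"
      have "P (agree (\<Union>(insert \<tau> S)) ?i) > 0"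
        using k \<tau>V less.prems(2) prob_pos_iff[OF S(3), of i]
        unfolding prob_pos_iff[OF parent_closedD(3)[OF closed]]
        by (auto simp: override_on_def states_def dest: PiE_mem)
      moreover have "card (comps - insert \<tau> S) < card (comps - S)"
        by (rule psubset_card_mono) (use \<tau> finite_comps in auto)
      note less.hyps[OF this closed]
      ultimately have "P (agree (\<Union>(insert \<tau> S)) ?i) = (\<Prod>\<tau>\<in>insert \<tau> S. cpr \<tau> ?i (pa \<tau>) ?i)"
        by blast
      also have "\<dots> = cpr \<tau> ?i (pa \<tau>) ?i * (\<Prod>\<tau>\<in>S. cpr \<tau> ?i (pa \<tau>) ?i)"
        using S(2) \<tau>(2) by simp
      also have "cpr \<tau> ?i (pa \<tau>) ?i = cpr \<tau> k (pa \<tau>) i"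
        by (rule cpr_cong) (use disj pa_S in \<open>auto simp: override_on_def\<close>)
      also have "(\<Prod>\<tau>\<in>S. cpr \<tau> ?i (pa \<tau>) ?i) = (\<Prod>\<tau>\<in>S. cpr \<tau> i (pa \<tau>) i)"
      proof (rule prod.cong[OF refl])
        fix \<sigma> assume "\<sigma> \<in> S"
        then have "\<sigma> \<subseteq> \<Union>S" "pa \<sigma> \<subseteq> \<Union>S" using S(4) by blast+
        then show "cpr \<sigma> ?i (pa \<sigma>) ?i = cpr \<sigma> i (pa \<sigma>) i"
          using disj by (intro cpr_cong) (auto simp: override_on_def)
      qed
      finally show ?thesis unfolding split .
    qed
    then have "P (agree (\<Union>S) i) =
        (\<Sum>k\<in>states d \<tau>. cpr \<tau> k (pa \<tau>) i * (\<Prod>\<tau>\<in>S. cpr \<tau> i (pa \<tau>) i))"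
      unfolding prob_sum_states[OF \<tau>V, of "agree (\<Union>S) i"] by (rule sum.cong[OF refl])
    then show ?thesis
      using sum_cpr_eq_1[OF \<tau>V prob_pos_mono[OF pa_S S(3) less.prems(2)]]
      by (simp add: sum_distrib_right[symmetric])
  qed
qed

text \<open>The nondescendants form a parent-closed family and remain one when \<tau> is added. The
  two factorizations differ by the factor of \<tau> alone, so their quotient is that factor.\<close>

lemma local_Markov_of_prob_factorization:
  assumes fact: "\<And>i. P (agree V i) > 0 \<Longrightarrow> P (agree V i) = (\<Prod>\<tau>\<in>comps. cpr \<tau> i (pa \<tau>) i)"
    and \<tau>: "\<tau> \<in> comps" and pos: "P (agree (nd \<tau>) i) > 0"
  shows "cpr \<tau> j (nd \<tau>) i = cpr \<tau> j (pa \<tau>) i"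
proof (cases "\<forall>v\<in>\<tau>. j v \<in> {1..d v}")
  case False
  then show ?thesis using cpr_eq_0[OF comps_subset[OF \<tau>]] by metis
next
  case True
  define N where "N = {\<tau>' \<in> comps - {\<tau>}. (\<tau>, \<tau>') \<notin> (component_edges V E)\<^sup>+}"
  have nd: "nd \<tau> = \<Union>N" unfolding N_def nd_D_def ..
  have \<tau>N: "\<tau> \<notin> N" unfolding N_def by blast
  have edge: "\<tau>' \<in> comps \<and> \<tau>' \<noteq> \<tau>''" if "(\<tau>', \<tau>'') \<in> component_edges V E" for \<tau>' \<tau>''
    using that acyclic_component_edges unfolding acyclic_def component_edges_def by blast
  \<comment> \<open>An edge from a descendant back to \<tau> would close a cycle, so the parents of
    \<tau> are all in \<open>N\<close>.\<close>
  have down: "(\<tau>', \<tau>) \<notin> component_edges V E" if "(\<tau>, \<tau>') \<in> (component_edges V E)\<^sup>+" for \<tau>'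
    using that acyclic_component_edges unfolding acyclic_def by (meson trancl_into_trancl)
  have closed: "parent_closed N"
    unfolding parent_closed_def N_def using edge by (blast intro: trancl_into_trancl)
  moreover have "\<tau>' \<in> N" if "(\<tau>', \<tau>) \<in> component_edges V E" for \<tau>'
    unfolding N_def using edge[OF that] down that by blast
  ultimately have closed': "parent_closed (insert \<tau> N)"
    using \<tau> unfolding parent_closed_def by blast
  have prod: "P (agree (\<Union>S) k) = (\<Prod>\<tau>\<in>S. cpr \<tau> k (pa \<tau>) k)"
    if "parent_closed S" "P (agree (\<Union>S) k) > 0" for S k
    by (rule prob_factorization_parent_closed[OF fact]) (use that in auto)
  \<comment> \<open>One vector for both families: \<open>j\<close> on \<tau>, \<open>i\<close>
    elsewhere.\<close>
  let ?e = "override_on i j \<tau>"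
  have disj: "\<tau> \<inter> \<Union>N = {}" using nd_disjoint[OF \<tau>] nd by simp
  have split: "agree (\<Union>(insert \<tau> N)) ?e = agree \<tau> j \<inter> agree (\<Union>N) i"
    using disj by (simp add: agree_Un agree_override_subset agree_override_disjoint)
  have e: "agree (\<Union>N) ?e = agree (\<Union>N) i" using disj by (simp add: agree_override_disjoint)
  have "P (agree (\<Union>(insert \<tau> N)) ?e) > 0"
    using True pos prob_pos_iff[OF nd_subset[of \<tau>], of i]
    unfolding prob_pos_iff[OF parent_closedD(3)[OF closed']] nd by (auto simp: override_on_def)
  then have "P (agree \<tau> j \<inter> agree (\<Union>N) i) = (\<Prod>\<tau>\<in>insert \<tau> N. cpr \<tau> ?e (pa \<tau>) ?e)"
    using prod[OF closed', of ?e] unfolding split by blast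
  also have "\<dots> = cpr \<tau> ?e (pa \<tau>) ?e * (\<Prod>\<tau>\<in>N. cpr \<tau> ?e (pa \<tau>) ?e)"
    using parent_closedD(2)[OF closed] \<tau>N by simp
  also have "(\<Prod>\<tau>\<in>N. cpr \<tau> ?e (pa \<tau>) ?e) = P (agree (\<Union>N) i)"
    using prod[OF closed, of ?e] pos unfolding e nd by simp
  also have "cpr \<tau> ?e (pa \<tau>) ?e = cpr \<tau> j (pa \<tau>) i"
    by (rule cpr_cong) (use pa_disjoint[OF \<tau>] in \<open>auto simp: override_on_def\<close>)
  finally show ?thesis using pos unfolding nd by (simp add: cpr_def[of \<tau> j "\<Union>N"])
qed

lemma cond_indep_nd_iff:
  "(\<forall>\<tau>\<in>comps. cond_indep p \<tau> (nd \<tau> - pa \<tau>) (pa \<tau>)) \<longleftrightarrow>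
   (\<forall>i. P (agree V i) > 0 \<longrightarrow> P (agree V i) = (\<Prod>\<tau>\<in>comps. cpr \<tau> i (pa \<tau>) i))"
  (is "?L \<longleftrightarrow> ?R")
proof -
  have iff: "cond_indep p \<tau> (nd \<tau> - pa \<tau>) (pa \<tau>) \<longleftrightarrow>
      (\<forall>j i. P (agree (nd \<tau>) i) > 0 \<longrightarrow> cpr \<tau> j (nd \<tau>) i = cpr \<tau> j (pa \<tau>) i)" if "\<tau> \<in> comps" for \<tau>
    by (rule cond_indep_iff_conditioning[OF nd_disjoint[OF that] pa_subset_nd nd_subset])
  show ?thesis
  proof
    assume ?L
    then have markov: "cpr \<tau> j (nd \<tau>) i = cpr \<tau> j (pa \<tau>) i"
      if "\<tau> \<in> comps" "P (agree (nd \<tau>) i) > 0" for \<tau> j i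
      using iff that by blast
    have "parent_closed comps" unfolding parent_closed_def component_edges_def by blast
    have "P (agree (\<Union>comps) i) = (\<Prod>\<tau>\<in>comps. cpr \<tau> i (pa \<tau>) i)"
      if "P (agree (\<Union>comps) i) > 0" for i
      by (rule prob_factorization_of_local_Markov[OF markov \<open>parent_closed comps\<close>]) (use that in auto)
    then show ?R unfolding Union_comps by blast
  next
    assume ?R
    then show ?L using iff local_Markov_of_prob_factorization by blast
  qed
qed

section \<open>Disconnected sets and (C2b)\<close>

lemma cpr_max_connected_subsets:
  assumes indep: "\<And>\<sigma>. \<sigma> \<subseteq> \<tau> \<Longrightarrow> cond_indep p \<sigma> (\<tau> - Nb_G E \<sigma>) (pa \<tau>)"
    and \<tau>: "\<tau> \<in> comps" and \<delta>: "\<delta> \<subseteq> \<tau>" and pos: "P (agree (pa \<tau>) i) > 0"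
  shows "cpr \<delta> j (pa \<tau>) i = (\<Prod>\<gamma>\<in>max_connected_subsets E \<delta>. cpr \<gamma> j (pa \<tau>) i)"
proof -
  have fin: "finite \<delta>" by (rule finite_subset_comps[OF \<tau> \<delta>])
  have "cpr (\<Union>C) j (pa \<tau>) i = (\<Prod>\<gamma>\<in>C. cpr \<gamma> j (pa \<tau>) i)"
    if "finite C" "C \<subseteq> max_connected_subsets E \<delta>" for C j
    using that
  proof (induction C arbitrary: j)
    case empty
    then show ?case using cpr_empty[OF pos] by simp
  next
    case (insert \<gamma> C)
    \<comment> \<open>(C2b) for \<gamma> concerns everything in \<beta>, but only the pieces in
      \<open>C\<close> are wanted; the surplus \<rho> is summed out on both sides.\<close>
    define \<beta> where "\<beta> = \<tau> - Nb_G E \<gamma>"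
    define \<rho> where "\<rho> = \<beta> - \<Union>C"
    have \<gamma>: "\<gamma> \<in> max_connected_subsets E \<delta>" using insert.prems by blast
    have \<gamma>\<tau>: "\<gamma> \<subseteq> \<tau>" using max_connected_subsetsD(1)[OF \<gamma>] \<delta> by blast
    have C\<beta>: "\<Union>C \<subseteq> \<beta>" unfolding \<beta>_def
    proof (rule Nb_separatedI)
      show "\<Union>C \<subseteq> \<tau>" using insert.prems max_connected_subsetsD(1) \<delta> by blast
    next
      fix u v assume "u \<in> \<gamma>" "v \<in> \<Union>C"
      then obtain \<gamma>' where "\<gamma>' \<in> max_connected_subsets E \<delta>" "v \<in> \<gamma>'" "\<gamma> \<noteq> \<gamma>'"
        using insert by blast
      then show "u \<noteq> v \<and> (u, v) \<notin> E \<and> (v, u) \<notin> E"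
        using max_connected_subsets_separated[OF \<gamma>] \<open>u \<in> \<gamma>\<close> by blast
    qed
    have \<gamma>\<beta>: "\<gamma> \<inter> \<beta> = {}" unfolding \<beta>_def Nb_G_def by blast
    have \<beta>: "\<beta> = \<Union>C \<union> \<rho>" "\<rho> \<subseteq> V" "\<Union>C \<inter> \<rho> = {}" "\<gamma> \<inter> \<rho> = {}"
      using C\<beta> \<gamma>\<beta> comps_subset[OF \<tau>] unfolding \<rho>_def \<beta>_def by blast+
    have prod: "cpr (\<gamma> \<union> \<beta>) j (pa \<tau>) i = cpr \<gamma> j (pa \<tau>) i * cpr \<beta> j (pa \<tau>) i" for j
      using indep[OF \<gamma>\<tau>] pos unfolding \<beta>_def[symmetric] cond_indep_iff[OF \<gamma>\<beta>] by blast
    have "cpr (\<Union>(insert \<gamma> C)) j (pa \<tau>) i =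
        (\<Sum>k\<in>states d \<rho>. cpr (\<gamma> \<union> \<Union>C \<union> \<rho>) (override_on j k \<rho>) (pa \<tau>) i)"
      using cpr_sum_states[OF \<beta>(2), of "\<gamma> \<union> \<Union>C"] \<beta>(3,4) by (simp add: Int_Un_distrib2)
    also have "\<dots> = (\<Sum>k\<in>states d \<rho>. cpr \<gamma> j (pa \<tau>) i * cpr \<beta> (override_on j k \<rho>) (pa \<tau>) i)"
    proof (rule sum.cong[OF refl])
      fix k
      have "cpr \<gamma> (override_on j k \<rho>) (pa \<tau>) i = cpr \<gamma> j (pa \<tau>) i"
        by (rule cpr_cong) (use \<beta>(4) in \<open>auto simp: override_on_def\<close>)
      then show "cpr (\<gamma> \<union> \<Union>C \<union> \<rho>) (override_on j k \<rho>) (pa \<tau>) i =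
          cpr \<gamma> j (pa \<tau>) i * cpr \<beta> (override_on j k \<rho>) (pa \<tau>) i"
        using prod[of "override_on j k \<rho>"] \<beta>(1) by (simp add: Un_assoc)
    qed
    also have "\<dots> = cpr \<gamma> j (pa \<tau>) i * cpr (\<Union>C) j (pa \<tau>) i"
      unfolding cpr_sum_states[OF \<beta>(2,3), of j] by (simp add: \<beta>(1) sum_distrib_left)
    finally show ?case using insert by simp
  qed
  from this[OF finite_max_connected_subsets[OF fin] subset_refl]
  show ?thesis by (simp add: Union_max_connected_subsets[OF fin])
qed

text \<open>The empty set gives 1 on both sides and a connected set is its own only piece, so the
  hypothesis on disconnected sets extends to all subsets of \<tau>.\<close>

lemma reduced_product_all:
  assumes disc: "\<And>\<delta> j. \<delta> \<subseteq> \<tau> \<Longrightarrow> disconnected_set E \<delta> \<Longrightarrow> \<forall>v\<in>\<delta>. j v \<in> {1..<d v} \<Longrightarrow>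
      cpr \<delta> j (pa \<tau>) i = (\<Prod>\<gamma>\<in>max_connected_subsets E \<delta>. cpr \<gamma> j (pa \<tau>) i)"
    and pos: "P (agree (pa \<tau>) i) > 0"
    and \<delta>: "\<delta> \<subseteq> \<tau>" "\<forall>v\<in>\<delta>. j v \<in> {1..<d v}"
  shows "cpr \<delta> j (pa \<tau>) i = (\<Prod>\<gamma>\<in>max_connected_subsets E \<delta>. cpr \<gamma> j (pa \<tau>) i)"
proof -
  consider "\<delta> = {}" | "connected_set E \<delta>" | "disconnected_set E \<delta>"
    unfolding disconnected_set_def by blast
  then show ?thesis
  proof cases
    case 1
    then show ?thesis using cpr_empty[OF pos] by (simp add: max_connected_subsets_empty)
  next
    case 2
    then show ?thesis by (simp add: max_connected_subsets_connected)
  next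
    case 3
    then show ?thesis using disc \<delta> by blast
  qed
qed

text \<open>No edge joins \<sigma> to \<beta>, so the connected pieces of any subset
  \<open>A\<close> are those of its two traces, and the product over the pieces of \<open>A\<close>
  splits accordingly. This settles reduced states, and inclusion-exclusion the others.\<close>

lemma cond_indep_nonneighbors:
  assumes disc: "\<And>\<delta> j i. \<delta> \<subseteq> \<tau> \<Longrightarrow> disconnected_set E \<delta> \<Longrightarrow> \<forall>v\<in>\<delta>. j v \<in> {1..<d v} \<Longrightarrow>
      P (agree (pa \<tau>) i) > 0 \<Longrightarrow>
      cpr \<delta> j (pa \<tau>) i = (\<Prod>\<gamma>\<in>max_connected_subsets E \<delta>. cpr \<gamma> j (pa \<tau>) i)"
    and \<tau>: "\<tau> \<in> comps" and \<sigma>: "\<sigma> \<subseteq> \<tau>"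
  shows "cond_indep p \<sigma> (\<tau> - Nb_G E \<sigma>) (pa \<tau>)"
proof -
  define \<beta> where "\<beta> = \<tau> - Nb_G E \<sigma>"
  have disj: "\<sigma> \<inter> \<beta> = {}" unfolding \<beta>_def Nb_G_def by blast
  have sep: "(u, v) \<notin> E \<and> (v, u) \<notin> E" if "u \<in> \<sigma>" "v \<in> \<beta>" for u v
    using Nb_separated[OF \<tau> \<sigma>] that unfolding \<beta>_def by blast
  have sub: "\<sigma> \<union> \<beta> \<subseteq> \<tau>" using \<sigma> unfolding \<beta>_def by blast
  have V: "\<tau> \<subseteq> V" by (rule comps_subset[OF \<tau>])
  have "cpr (\<sigma> \<union> \<beta>) j (pa \<tau>) i = cpr \<sigma> j (pa \<tau>) i * cpr \<beta> j (pa \<tau>) i"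
    if pos: "P (agree (pa \<tau>) i) > 0" for j i
  proof (cases "\<forall>v\<in>\<sigma> \<union> \<beta>. j v \<in> {1..d v}")
    case False
    then have "cpr (\<sigma> \<union> \<beta>) j (pa \<tau>) i = 0" "cpr \<sigma> j (pa \<tau>) i = 0 \<or> cpr \<beta> j (pa \<tau>) i = 0"
      using cpr_eq_0[of "\<sigma> \<union> \<beta>" j] cpr_eq_0[of \<sigma> j] cpr_eq_0[of \<beta> j] sub V by blast+
    then show ?thesis by auto
  next
    case True
    let ?f = "\<lambda>A j. cpr A j (pa \<tau>) i"
    have "?f (\<sigma> \<union> \<beta>) j = ?f ((\<sigma> \<union> \<beta>) \<inter> \<sigma>) j * ?f ((\<sigma> \<union> \<beta>) \<inter> \<beta>) j"
    proof (rule eq_on_states_if_eq_on_reduced[where f = ?f and U = "\<sigma> \<union> \<beta>"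
          and g = "\<lambda>A j. ?f (A \<inter> \<sigma>) j * ?f (A \<inter> \<beta>) j"])
      fix A v j assume A: "insert v A \<subseteq> \<sigma> \<union> \<beta>" "v \<notin> A"
      then have v: "v \<in> V" using sub V by blast
      show "?f A j = (\<Sum>l\<in>{1..d v}. ?f (insert v A) (j(v := l)))"
        by (rule cpr_sum_coordinate[OF v A(2)])
      \<comment> \<open>The new coordinate enters one factor only and the other is constant in
        \<open>l\<close>; \<rho> and \<open>\<rho>'\<close> are \<sigma> and \<beta> in either
        order.\<close>
      have step: "?f (A \<inter> \<rho>) j * ?f (A \<inter> \<rho>') j =
          (\<Sum>l\<in>{1..d v}. ?f (insert v A \<inter> \<rho>) (j(v := l)) * ?f (insert v A \<inter> \<rho>') (j(v := l)))"
        if \<rho>: "v \<in> \<rho>" "v \<notin> \<rho>'" for \<rho> \<rho>'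
      proof -
        have "insert v A \<inter> \<rho> = insert v (A \<inter> \<rho>)" "insert v A \<inter> \<rho>' = A \<inter> \<rho>'"
          using \<rho> by blast+
        moreover have "?f (A \<inter> \<rho>') (j(v := l)) = ?f (A \<inter> \<rho>') j" for l
          by (rule cpr_cong) (use \<rho> in auto)
        ultimately show ?thesis
          using cpr_sum_coordinate[OF v, of "A \<inter> \<rho>" j "pa \<tau>" i] A(2)
          by (simp add: sum_distrib_right)
      qed
      show "?f (A \<inter> \<sigma>) j * ?f (A \<inter> \<beta>) j =
          (\<Sum>l\<in>{1..d v}. ?f (insert v A \<inter> \<sigma>) (j(v := l)) * ?f (insert v A \<inter> \<beta>) (j(v := l)))"
      proof (cases "v \<in> \<sigma>")
        case True
        then show ?thesis using step[of \<sigma> \<beta>] disj by blast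
      next
        case False
        then have "v \<in> \<beta>" using A(1) by blast
        then show ?thesis using step[of \<beta> \<sigma>] False by (simp add: mult.commute)
      qed
    next
      fix A j assume A: "A \<subseteq> \<sigma> \<union> \<beta>" "\<forall>v\<in>A. j v \<in> {1..<d v}"
      have red: "?f B j = (\<Prod>\<gamma>\<in>max_connected_subsets E B. ?f \<gamma> j)" if "B \<subseteq> A" for B
        by (rule reduced_product_all[OF disc pos]) (use that A sub pos in auto)
      have A_split: "A = (A \<inter> \<sigma>) \<union> (A \<inter> \<beta>)" using A(1) by blast
      have fin: "finite (A \<inter> \<sigma>)" "finite (A \<inter> \<beta>)"
        using finite_subset_comps[OF \<tau>] sub by blast+
      have "max_connected_subsets E (A \<inter> \<sigma>) \<inter> max_connected_subsets E (A \<inter> \<beta>) = {}"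
      proof (rule ccontr)
        assume "\<not> ?thesis"
        then obtain \<gamma> where "\<gamma> \<in> max_connected_subsets E (A \<inter> \<sigma>)"
          "\<gamma> \<in> max_connected_subsets E (A \<inter> \<beta>)" by blast
        note this[THEN max_connected_subsetsD(1)] max_connected_subsetsD(2)[OF this(1)]
        then show False using disj unfolding connected_set_def by blast
      qed
      moreover have "max_connected_subsets E A =
          max_connected_subsets E (A \<inter> \<sigma>) \<union> max_connected_subsets E (A \<inter> \<beta>)"
        using max_connected_subsets_Un[of "A \<inter> \<sigma>" "A \<inter> \<beta>" E] sep disj A_split by auto
      ultimately show "?f A j = ?f (A \<inter> \<sigma>) j * ?f (A \<inter> \<beta>) j"
        using red[of A] red[of "A \<inter> \<sigma>"] red[of "A \<inter> \<beta>"]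
        by (simp add: prod.union_disjoint finite_max_connected_subsets fin)
    qed (use True finite_subset_comps[OF \<tau> sub] in auto)
    moreover have "(\<sigma> \<union> \<beta>) \<inter> \<sigma> = \<sigma>" "(\<sigma> \<union> \<beta>) \<inter> \<beta> = \<beta>" by blast+
    ultimately show ?thesis by simp
  qed
  then show ?thesis unfolding \<beta>_def[symmetric] cond_indep_iff[OF disj] by blast
qed

section \<open>Dependence on parents and (C3b)\<close>

lemma cond_indep_nonparents_iff:
  assumes \<tau>: "\<tau> \<in> comps" and \<sigma>: "\<sigma> \<subseteq> \<tau>"
  shows "cond_indep p \<sigma> (pa \<tau> - pa_G E \<sigma>) (pa_G E \<sigma>) \<longleftrightarrow>
    (\<forall>j i. P (agree (pa \<tau>) i) > 0 \<longrightarrow> cpr \<sigma> j (pa \<tau>) i = cpr \<sigma> j (pa_G E \<sigma>) i)"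
  by (rule cond_indep_iff_conditioning)
    (use pa_disjoint[OF \<tau>] \<sigma> pa_G_subset_pa[OF \<tau> \<sigma>] pa_subset in auto)

lemma cond_indep_nonparents:
  assumes disc: "\<And>\<delta> j i. \<delta> \<subseteq> \<tau> \<Longrightarrow> disconnected_set E \<delta> \<Longrightarrow> \<forall>v\<in>\<delta>. j v \<in> {1..<d v} \<Longrightarrow>
      P (agree (pa \<tau>) i) > 0 \<Longrightarrow>
      cpr \<delta> j (pa \<tau>) i = (\<Prod>\<gamma>\<in>max_connected_subsets E \<delta>. cpr \<gamma> j (pa \<tau>) i)"
    and conn: "\<And>\<gamma> j i k. \<gamma> \<subseteq> \<tau> \<Longrightarrow> connected_set E \<gamma> \<Longrightarrow> \<forall>v\<in>\<gamma>. j v \<in> {1..<d v} \<Longrightarrow>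
      P (agree (pa \<tau>) i) > 0 \<Longrightarrow> P (agree (pa \<tau>) k) > 0 \<Longrightarrow> \<forall>v\<in>pa_G E \<gamma>. i v = k v \<Longrightarrow>
      cpr \<gamma> j (pa \<tau>) i = cpr \<gamma> j (pa \<tau>) k"
    and \<tau>: "\<tau> \<in> comps" and \<sigma>: "\<sigma> \<subseteq> \<tau>"
  shows "cond_indep p \<sigma> (pa \<tau> - pa_G E \<sigma>) (pa_G E \<sigma>)"
proof -
  have V: "\<tau> \<subseteq> V" by (rule comps_subset[OF \<tau>])
  \<comment> \<open>Invariance for arbitrary \<sigma>: on reduced states both sides split into
    connected pieces, whose parents are parents of \<sigma>, so the invariance assumed for connected
    sets applies to each factor.\<close>
  have eq: "cpr \<sigma> j (pa \<tau>) i = cpr \<sigma> j (pa \<tau>) k"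
    if i: "P (agree (pa \<tau>) i) > 0" and k: "P (agree (pa \<tau>) k) > 0" and ik: "\<forall>v\<in>pa_G E \<sigma>. i v = k v"
    for j i k
  proof (cases "\<forall>v\<in>\<sigma>. j v \<in> {1..d v}")
    case False
    then show ?thesis using cpr_eq_0[of \<sigma> j] \<sigma> V by (metis subset_trans)
  next
    case True
    show ?thesis
    proof (rule eq_on_states_if_eq_on_reduced[where U = \<sigma> and A = \<sigma>
          and f = "\<lambda>A j. cpr A j (pa \<tau>) i" and g = "\<lambda>A j. cpr A j (pa \<tau>) k"])
      fix A j assume A: "A \<subseteq> \<sigma>" "\<forall>v\<in>A. j v \<in> {1..<d v}"
      have A\<tau>: "A \<subseteq> \<tau>" using A \<sigma> by blast
      have "cpr A j (pa \<tau>) i = (\<Prod>\<gamma>\<in>max_connected_subsets E A. cpr \<gamma> j (pa \<tau>) i)"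
        by (rule reduced_product_all[OF disc i A\<tau> A(2)]) (use i in auto)
      also have "\<dots> = (\<Prod>\<gamma>\<in>max_connected_subsets E A. cpr \<gamma> j (pa \<tau>) k)"
      proof (rule prod.cong[OF refl])
        fix \<gamma> assume "\<gamma> \<in> max_connected_subsets E A"
        note \<gamma> = max_connected_subsetsD(1,2)[OF this]
        have "pa_G E \<gamma> \<subseteq> pa_G E \<sigma>" by (rule pa_G_mono[OF \<tau> \<sigma>]) (use \<gamma> A in blast)
        then show "cpr \<gamma> j (pa \<tau>) i = cpr \<gamma> j (pa \<tau>) k"
          by (intro conn[OF _ \<gamma>(2) _ i k]) (use \<gamma>(1) A A\<tau> ik in blast)+
      qed
      also have "\<dots> = cpr A j (pa \<tau>) k"
        by (rule reduced_product_all[OF disc k A\<tau> A(2), symmetric]) (use k in auto)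
      finally show "cpr A j (pa \<tau>) i = cpr A j (pa \<tau>) k" .
    next
      fix A v j assume "insert v A \<subseteq> \<sigma>" "v \<notin> A"
      then have v: "v \<in> V" "v \<notin> A" using \<sigma> V by blast+
      show "cpr A j (pa \<tau>) i = (\<Sum>l\<in>{1..d v}. cpr (insert v A) (j(v := l)) (pa \<tau>) i)"
        "cpr A j (pa \<tau>) k = (\<Sum>l\<in>{1..d v}. cpr (insert v A) (j(v := l)) (pa \<tau>) k)"
        by (rule cpr_sum_coordinate[OF v])+
    qed (use True finite_subset_comps[OF \<tau> \<sigma>] in auto)
  qed
  have sub: "pa_G E \<sigma> \<subseteq> pa \<tau>" by (rule pa_G_subset_pa[OF \<tau> \<sigma>])
  have "cpr \<sigma> j (pa \<tau>) i = cpr \<sigma> j (pa_G E \<sigma>) i" if pos: "P (agree (pa \<tau>) i) > 0" for j i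
  \<comment> \<open>The value given \<open>pa_G E \<sigma>\<close> averages values at configurations
    that share these coordinates with \<open>i\<close>; by \<open>eq\<close> they all equal the
    value at \<open>i\<close>.\<close>
  proof (rule sym, rule cpr_average[OF sub pa_subset])
    show "P (agree (pa_G E \<sigma>) i) > 0" by (rule prob_pos_mono[OF sub pa_subset pos])
  qed (use eq[OF _ pos] in auto)
  then show ?thesis unfolding cond_indep_nonparents_iff[OF \<tau> \<sigma>] by blast
qed

lemma cpr_cong_of_cond_indep_nonparents:
  assumes \<tau>: "\<tau> \<in> comps" and \<sigma>: "\<sigma> \<subseteq> \<tau>"
    and indep: "cond_indep p \<sigma> (pa \<tau> - pa_G E \<sigma>) (pa_G E \<sigma>)"
    and pos: "P (agree (pa \<tau>) i) > 0" "P (agree (pa \<tau>) k) > 0" and ik: "\<forall>v\<in>pa_G E \<sigma>. i v = k v"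
  shows "cpr \<sigma> j (pa \<tau>) i = cpr \<sigma> j (pa \<tau>) k"
proof -
  have "cpr \<sigma> j (pa \<tau>) i = cpr \<sigma> j (pa_G E \<sigma>) i" "cpr \<sigma> j (pa \<tau>) k = cpr \<sigma> j (pa_G E \<sigma>) k"
    using indep pos unfolding cond_indep_nonparents_iff[OF \<tau> \<sigma>] by blast+
  moreover have "cpr \<sigma> j (pa_G E \<sigma>) i = cpr \<sigma> j (pa_G E \<sigma>) k"
    by (rule cpr_cong) (use ik in auto)
  ultimately show ?thesis by simp
qed

text \<open>The equivalence for total vectors, with positive probability in place of membership in
  \<open>states\<close>; afterwards only the three conditions have to be translated.\<close>

lemma mem_P_IV_iff:
  "p \<in> P_IV V E d \<longleftrightarrow>
    (\<forall>i. P (agree V i) > 0 \<longrightarrow> P (agree V i) = (\<Prod>\<tau>\<in>comps. cpr \<tau> i (pa \<tau>) i)) \<and>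
    (\<forall>\<tau>\<in>comps. \<forall>i \<delta> j. P (agree (pa \<tau>) i) > 0 \<longrightarrow> \<delta> \<subseteq> \<tau> \<longrightarrow> disconnected_set E \<delta> \<longrightarrow>
      (\<forall>v\<in>\<delta>. j v \<in> {1..<d v}) \<longrightarrow>
      cpr \<delta> j (pa \<tau>) i = (\<Prod>\<gamma>\<in>max_connected_subsets E \<delta>. cpr \<gamma> j (pa \<tau>) i)) \<and>
    (\<forall>\<tau>\<in>comps. \<forall>\<gamma> j i k. \<gamma> \<subseteq> \<tau> \<longrightarrow> connected_set E \<gamma> \<longrightarrow> (\<forall>v\<in>\<gamma>. j v \<in> {1..<d v}) \<longrightarrow>
      P (agree (pa \<tau>) i) > 0 \<longrightarrow> P (agree (pa \<tau>) k) > 0 \<longrightarrow> (\<forall>v\<in>pa_G E \<gamma>. i v = k v) \<longrightarrow>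
      cpr \<gamma> j (pa \<tau>) i = cpr \<gamma> j (pa \<tau>) k)"
  (is "_ \<longleftrightarrow> ?i \<and> ?ii \<and> ?iii")
proof
  assume "p \<in> P_IV V E d"
  then have C: "\<And>\<tau>. \<tau> \<in> comps \<Longrightarrow> cond_indep p \<tau> (nd \<tau> - pa \<tau>) (pa \<tau>)"
    "\<And>\<tau> \<sigma>. \<tau> \<in> comps \<Longrightarrow> \<sigma> \<subseteq> \<tau> \<Longrightarrow> cond_indep p \<sigma> (\<tau> - Nb_G E \<sigma>) (pa \<tau>)"
    "\<And>\<tau> \<sigma>. \<tau> \<in> comps \<Longrightarrow> \<sigma> \<subseteq> \<tau> \<Longrightarrow> cond_indep p \<sigma> (pa \<tau> - pa_G E \<sigma>) (pa_G E \<sigma>)"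
    unfolding P_IV_def by blast+
  show "?i \<and> ?ii \<and> ?iii"
  proof (intro conjI)
    show ?i using cond_indep_nd_iff C(1) by blast
    show ?ii by (intro ballI allI impI) (rule cpr_max_connected_subsets[OF C(2)])
    show ?iii
      by (intro ballI allI impI) (rule cpr_cong_of_cond_indep_nonparents[OF _ _ C(3)])
  qed
next
  assume R: "?i \<and> ?ii \<and> ?iii"
  have nd: "cond_indep p \<tau> (nd \<tau> - pa \<tau>) (pa \<tau>)" if "\<tau> \<in> comps" for \<tau>
    using R that cond_indep_nd_iff by blast
  have nb: "cond_indep p \<sigma> (\<tau> - Nb_G E \<sigma>) (pa \<tau>)" if "\<tau> \<in> comps" "\<sigma> \<subseteq> \<tau>" for \<tau> \<sigma>
    by (rule cond_indep_nonneighbors[OF _ that]) (use R that(1) in blast)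
  have pa: "cond_indep p \<sigma> (pa \<tau> - pa_G E \<sigma>) (pa_G E \<sigma>)" if "\<tau> \<in> comps" "\<sigma> \<subseteq> \<tau>" for \<tau> \<sigma>
    by (rule cond_indep_nonparents[OF _ _ that]) (use R that(1) in blast)+
  show "p \<in> P_IV V E d" unfolding P_IV_def using interior nd nb pa by blast
qed

section \<open>Translation from total vectors to states\<close>

lemma all_states_iff:
  assumes "A \<subseteq> V" "\<And>i. Q (restrict i A) \<longleftrightarrow> Q i"
  shows "(\<forall>i\<in>states d A. Q i) \<longleftrightarrow> (\<forall>i. P (agree A i) > 0 \<longrightarrow> Q i)"
  using assms prob_pos_states restrict_mem_states by blast

text \<open>\<open>agree V i\<close> also contains vectors that differ from \<open>i\<close> off
  \<open>V\<close>, but these lie outside the support.\<close>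

lemma prob_agree_eq_pmf:
  assumes "i \<in> states d V"
  shows "P (agree V i) = pmf p i"
proof -
  have "P (agree V i) = P {i}"
  proof (rule measure_pmf.finite_measure_eq_AE)
    have "x = i" if "x \<in> states d V" "x \<in> agree V i" for x
      using that assms unfolding states_def agree_def by (auto intro: PiE_ext)
    then show "AE x in measure_pmf p. x \<in> agree V i \<longleftrightarrow> x \<in> {i}"
      by (auto intro!: AE_pmfI simp: set_pmf_eq agree_def)
  qed auto
  then show ?thesis by (simp add: measure_pmf_single)
qed

lemma moebius_param_eq_cpr:
  "moebius_param V E p \<tau> \<sigma> (restrict j \<sigma>) (restrict i (pa \<tau>)) = cpr \<sigma> j (pa \<tau>) i"
  unfolding moebius_param_def by (rule cprob_eq_cpr)

lemma factorization_iff: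
  "(\<forall>i\<in>states d V. pmf p i =
      (\<Prod>\<tau>\<in>comps. cprob p \<tau> (restrict i \<tau>) (pa \<tau>) (restrict i (pa \<tau>)))) \<longleftrightarrow>
    (\<forall>i. P (agree V i) > 0 \<longrightarrow> P (agree V i) = (\<Prod>\<tau>\<in>comps. cpr \<tau> i (pa \<tau>) i))"
proof -
  let ?Q = "\<lambda>i. P (agree V i) = (\<Prod>\<tau>\<in>comps. cpr \<tau> i (pa \<tau>) i)"
  have "?Q (restrict i V) \<longleftrightarrow> ?Q i" for i
  proof -
    have "agree V (restrict i V) = agree V i" by (rule agree_cong) simp
    moreover have "(\<Prod>\<tau>\<in>comps. cpr \<tau> (restrict i V) (pa \<tau>) (restrict i V)) =
        (\<Prod>\<tau>\<in>comps. cpr \<tau> i (pa \<tau>) i)"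
      by (intro prod.cong refl cpr_cong) (use comps_subset pa_subset in auto)
    ultimately show ?thesis by simp
  qed
  then have "(\<forall>i\<in>states d V. ?Q i) \<longleftrightarrow> (\<forall>i. P (agree V i) > 0 \<longrightarrow> ?Q i)"
    by (rule all_states_iff[OF subset_refl])
  then show ?thesis by (simp add: prob_agree_eq_pmf cprob_eq_cpr)
qed

lemma restrict_mem_reduced_states: "\<forall>v\<in>\<sigma>. j v \<in> {1..<d v} \<Longrightarrow> restrict j \<sigma> \<in> reduced_states d \<sigma>"
  unfolding reduced_states_def by auto

lemma reduced_states_restrict: "j \<in> reduced_states d \<sigma> \<Longrightarrow> restrict j \<sigma> = j"
  unfolding reduced_states_def by (rule PiE_restrict)

lemma reduced_states_mem: "j \<in> reduced_states d \<sigma> \<Longrightarrow> \<forall>v\<in>\<sigma>. j v \<in> {1..<d v}"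
  unfolding reduced_states_def by (blast dest: PiE_mem)

lemma states_restrict: "i \<in> states d A \<Longrightarrow> restrict i A = i"
  unfolding states_def by (rule PiE_restrict)

lemma disconnected_iff:
  "(\<forall>i\<in>states d (pa \<tau>). \<forall>\<delta>. \<delta> \<subseteq> \<tau> \<and> disconnected_set E \<delta> \<longrightarrow>
      (\<forall>j\<in>reduced_states d \<delta>. moebius_param V E p \<tau> \<delta> j i =
         (\<Prod>\<gamma>\<in>max_connected_subsets E \<delta>. moebius_param V E p \<tau> \<gamma> (restrict j \<gamma>) i))) \<longleftrightarrow>
    (\<forall>i \<delta> j. P (agree (pa \<tau>) i) > 0 \<longrightarrow> \<delta> \<subseteq> \<tau> \<longrightarrow> disconnected_set E \<delta> \<longrightarrow>
      (\<forall>v\<in>\<delta>. j v \<in> {1..<d v}) \<longrightarrow>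
      cpr \<delta> j (pa \<tau>) i = (\<Prod>\<gamma>\<in>max_connected_subsets E \<delta>. cpr \<gamma> j (pa \<tau>) i))"
  (is "?L \<longleftrightarrow> ?R")
proof
  assume L: ?L
  show ?R
  proof (intro allI impI)
    fix i \<delta> j
    assume *: "P (agree (pa \<tau>) i) > 0" "\<delta> \<subseteq> \<tau>" "disconnected_set E \<delta>" "\<forall>v\<in>\<delta>. j v \<in> {1..<d v}"
    have "moebius_param V E p \<tau> \<delta> (restrict j \<delta>) (restrict i (pa \<tau>)) =
        (\<Prod>\<gamma>\<in>max_connected_subsets E \<delta>.
          moebius_param V E p \<tau> \<gamma> (restrict (restrict j \<delta>) \<gamma>) (restrict i (pa \<tau>)))"
      using L restrict_mem_states[OF pa_subset *(1)] restrict_mem_reduced_states[OF *(4)] *(2,3)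
      by blast
    then show "cpr \<delta> j (pa \<tau>) i = (\<Prod>\<gamma>\<in>max_connected_subsets E \<delta>. cpr \<gamma> j (pa \<tau>) i)"
      unfolding moebius_param_eq_cpr
      \<comment> \<open>The nested restriction is harmless because each piece \<gamma> is contained
        in \<delta>.\<close>
      by (rule trans) (intro prod.cong refl cpr_cong, use max_connected_subsetsD(1) in auto)
  qed
next
  assume R: ?R
  show ?L
  proof (intro ballI allI impI, elim conjE)
    fix i \<delta> j
    assume *: "i \<in> states d (pa \<tau>)" "\<delta> \<subseteq> \<tau>" "disconnected_set E \<delta>" "j \<in> reduced_states d \<delta>"
    have "cpr \<delta> j (pa \<tau>) i = (\<Prod>\<gamma>\<in>max_connected_subsets E \<delta>. cpr \<gamma> j (pa \<tau>) i)"
      using R prob_pos_states[OF pa_subset *(1)] *(2,3) reduced_states_mem[OF *(4)] by blast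
    then show "moebius_param V E p \<tau> \<delta> j i =
        (\<Prod>\<gamma>\<in>max_connected_subsets E \<delta>. moebius_param V E p \<tau> \<gamma> (restrict j \<gamma>) i)"
      unfolding moebius_param_eq_cpr[symmetric] states_restrict[OF *(1)]
        reduced_states_restrict[OF *(4)] .
  qed
qed

lemma connected_iff:
  assumes \<tau>: "\<tau> \<in> comps"
  shows "(\<forall>\<gamma>. \<gamma> \<subseteq> \<tau> \<and> connected_set E \<gamma> \<longrightarrow> (\<forall>j\<in>reduced_states d \<gamma>.
      \<forall>i\<in>states d (pa \<tau>). \<forall>k\<in>states d (pa \<tau>). restrict i (pa_G E \<gamma>) = restrict k (pa_G E \<gamma>) \<longrightarrow>
      moebius_param V E p \<tau> \<gamma> j i = moebius_param V E p \<tau> \<gamma> j k)) \<longleftrightarrow>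
    (\<forall>\<gamma> j i k. \<gamma> \<subseteq> \<tau> \<longrightarrow> connected_set E \<gamma> \<longrightarrow> (\<forall>v\<in>\<gamma>. j v \<in> {1..<d v}) \<longrightarrow>
      P (agree (pa \<tau>) i) > 0 \<longrightarrow> P (agree (pa \<tau>) k) > 0 \<longrightarrow> (\<forall>v\<in>pa_G E \<gamma>. i v = k v) \<longrightarrow>
      cpr \<gamma> j (pa \<tau>) i = cpr \<gamma> j (pa \<tau>) k)"
  (is "?L \<longleftrightarrow> ?R")
proof
  assume L: ?L
  show ?R
  proof (intro allI impI)
    fix \<gamma> j i k
    assume *: "\<gamma> \<subseteq> \<tau>" "connected_set E \<gamma>" "\<forall>v\<in>\<gamma>. j v \<in> {1..<d v}"
      "P (agree (pa \<tau>) i) > 0" "P (agree (pa \<tau>) k) > 0" "\<forall>v\<in>pa_G E \<gamma>. i v = k v"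
    \<comment> \<open>Restricting to \<open>pa \<tau>\<close> first loses nothing, since it contains
      \<open>pa_G E \<gamma>\<close>; this is where \<tau> being a component enters.\<close>
    have "restrict (restrict i (pa \<tau>)) (pa_G E \<gamma>) = restrict (restrict k (pa \<tau>)) (pa_G E \<gamma>)"
      using *(6) pa_G_subset_pa[OF \<tau> *(1)] by (auto simp: restrict_def fun_eq_iff)
    then have "moebius_param V E p \<tau> \<gamma> (restrict j \<gamma>) (restrict i (pa \<tau>)) =
        moebius_param V E p \<tau> \<gamma> (restrict j \<gamma>) (restrict k (pa \<tau>))"
      using L *(1,2) restrict_mem_reduced_states[OF *(3)]
        restrict_mem_states[OF pa_subset *(4)] restrict_mem_states[OF pa_subset *(5)] by blast
    then show "cpr \<gamma> j (pa \<tau>) i = cpr \<gamma> j (pa \<tau>) k" unfolding moebius_param_eq_cpr .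
  qed
next
  assume R: ?R
  show ?L
  proof (intro allI ballI impI, elim conjE)
    fix \<gamma> j i k
    assume *: "\<gamma> \<subseteq> \<tau>" "connected_set E \<gamma>" "j \<in> reduced_states d \<gamma>"
      "i \<in> states d (pa \<tau>)" "k \<in> states d (pa \<tau>)"
      "restrict i (pa_G E \<gamma>) = restrict k (pa_G E \<gamma>)"
    have "\<forall>v\<in>pa_G E \<gamma>. i v = k v" using *(6) by (metis restrict_apply')
    then have "cpr \<gamma> j (pa \<tau>) i = cpr \<gamma> j (pa \<tau>) k"
      using R *(1,2) reduced_states_mem[OF *(3)] prob_pos_states[OF pa_subset *(4)]
        prob_pos_states[OF pa_subset *(5)] by blast
    then show "moebius_param V E p \<tau> \<gamma> j i = moebius_param V E p \<tau> \<gamma> j k"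
      unfolding moebius_param_eq_cpr[symmetric] states_restrict[OF *(4)] states_restrict[OF *(5)]
        reduced_states_restrict[OF *(3)] .
  qed
qed

end

theorem theorem8:
  fixes V :: "'v set" and E :: "('v \<times> 'v) set"
    and d :: "'v \<Rightarrow> nat" and p :: "('v \<Rightarrow> nat) pmf"
  assumes "chain_graph V E"
    and "p \<in> prob_simplex_interior V d"
  shows "p \<in> P_IV V E d \<longleftrightarrow>
    (\<forall>i\<in>states d V.
       pmf p i = (\<Prod>\<tau>\<in>chain_components V E.
                    cprob p \<tau> (restrict i \<tau>) (pa_D V E \<tau>) (restrict i (pa_D V E \<tau>)))) \<and>
    (\<forall>\<tau>\<in>chain_components V E. \<forall>i\<in>states d (pa_D V E \<tau>).
       \<forall>\<delta>. \<delta> \<subseteq> \<tau> \<and> disconnected_set E \<delta> \<longrightarrow>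
         (\<forall>j\<in>reduced_states d \<delta>.
            moebius_param V E p \<tau> \<delta> j i =
              (\<Prod>\<gamma>\<in>max_connected_subsets E \<delta>. moebius_param V E p \<tau> \<gamma> (restrict j \<gamma>) i))) \<and>
    (\<forall>\<tau>\<in>chain_components V E. \<forall>\<gamma>. \<gamma> \<subseteq> \<tau> \<and> connected_set E \<gamma> \<longrightarrow>
       (\<forall>j\<in>reduced_states d \<gamma>.
          \<forall>i\<in>states d (pa_D V E \<tau>). \<forall>k\<in>states d (pa_D V E \<tau>).
            restrict i (pa_G E \<gamma>) = restrict k (pa_G E \<gamma>) \<longrightarrow>
            moebius_param V E p \<tau> \<gamma> j i = moebius_param V E p \<tau> \<gamma> j k))"
proof -
  interpret chain_graph_model V E d p
    using assms by unfold_locales (auto simp: chain_graph_def graph_def)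
  show ?thesis
    unfolding mem_P_IV_iff factorization_iff
    \<comment> \<open>The conjuncts are matched separately; the congruence for the bounded
      quantifier supplies \<open>\<tau> \<in> comps\<close>, the premise of
      \<open>connected_iff\<close>.\<close>
    by (intro arg_cong2[where f = "(\<and>)"] refl ball_cong)
      (simp_all only: disconnected_iff connected_iff)
qed

end
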